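(* Let $q\ge 2$, $k\ge 1$ and $t\ge 3$ be integers, let $\varepsilon>0$ be a constant, and let $P:[q]^k\to\{0,1\}$ be $(t-1)$-wise uniform supporting. Let $\mathcal{I}$ be a random instance of $\mathrm{CSP}(P)$ with $n$ variables and $m\le n^{t/2-\varepsilon}$ constraints. Then there is $r=\Omega(n^{\varepsilon/(t-2)})$ such that, with high probability, $\mathrm{SA}_+^r(R_{\mathcal{I}})$ is nonempty (equivalently, the $r$-round Sherali–Adams$_+$ relaxation of $\mathcal{I}$ has value $1$).
   Context: $P$ is $s$-wise uniform supporting if there is a probability distribution $\mu$ on $[q]^k$ supported on $P^{-1}(1)$ such that $\Pr_{z\sim\mu}[z_T=\alpha]=q^{-|T|}$ for every $T\subseteq[k]$ with $1\le |T|\le s$ and every $\alpha\in[q]^T$. An instance of $\mathrm{CSP}(P)$ on variables $x_1,\dots,x_n$ (taking values in $[q]$) is a multiset of constraints $(c,S)$ with $c\in[q]^k$ and $S\in[n]^k$, the constraint being $P(x_S+c)=1$ where $x_S=(x_{S_1},\dots,x_{S_k})$ and addition is componentwise mod $q$. A random instance with $m$ constraints has its $m$ constraints chosen independently and uniformly from all $q^kn^k$ possible pairs $(c,S)$. "With high probability" means with probability $1-o(1)$ as $n\to\infty$ with $q,k,t,\varepsilon,P$ fixed. Boolean encoding: use variables $x_{i,a}$ ($i\in[n]$, $a\in[q]$), intended as $x_{i,a}=1$ iff $x_i=a$. Let $P_{01}(z)=\sum_{\beta\in[q]^k}P(\beta)\prod_{j\in[k]}z_{j,\beta_j}$ for $z\in\mathbb{R}^{qk}$.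 For a constraint $(c,S)$ let $x^{(c)}_{S\times[q]}\in\mathbb{R}^{qk}$ have $(j,a)$-entry $x_{S_j,(a+c_j)\bmod q}$. Then $R_{\mathcal{I}}=\{P_{01}(x^{(c)}_{S\times[q]})=1 : (c,S)\in\mathcal{I}\}$. For $T\subseteq[n]$ and $\alpha\in[q]^T$, $\mathbf{1}_{\{x_T=\alpha\}}(x)=\prod_{i\in T}x_{i,\alpha_i}$. Degree means multilinear degree. A family $\{D_S\}_{S\subseteq[n],|S|\le r}$, with $D_S$ a distribution on $[q]^S$, is $r$-locally consistent if for all $T\subseteq S$ with $|S|\le r$ the marginal of $D_S$ on $T$ equals $D_T$. For a polynomial $p$ in the $x_{i,a}$ whose variables involve a set $V$ of at most $r$ indices $i$, set $\mathbb{E}_D[p]=\mathbb{E}_{y\sim D_V}[p(z(y))]$ where $z(y)_{i,a}=1$ if $y_i=a$ and $0$ otherwise. $\mathrm{SA}^r(R_{\mathcal{I}})$ is the set of $r$-locally consistent families such that $\mathbb{E}_D[\mathbf{1}_{\{x_T=\alpha\}}(x)\cdot(P_{01}(x^{(c)}_{S\times[q]})-1)]=0$ for every $(c,S)\in\mathcal{I}$, $T\subseteq[n]$, $\alpha\in[q]^T$ for which this polynomial has degree at most $r$. $\mathrm{SA}_+^r(R_{\mathcal{I}})$ consists of those families in $\mathrm{SA}^r(R_{\mathcal{I}})$ for which the symmetric matrix $M$ indexed by $\{0\}\cup([n]\times[q])$ with $M(0,0)=1$, $M(0,(i,a))=D_{\{i\}}(x_i=a)$, $M((i,a),(j,b))=D_{\{i,j\}}(x_i=a\wedge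 x_j=b)$ is positive semidefinite. *)

theory Defs
  imports
    "HOL-Probability.Probability"
    "HOL-Library.Poly_Mapping"
    "HOL-Library.Landau_Symbols"
begin

text \<open>Throughout, \<open>[q]\<close>, \<open>[k]\<close>, \<open>[n]\<close> are the initial segments \<open>{..<q}\<close>, \<open>{..<k}\<close>, \<open>{..<n}\<close> of the
  naturals (so that addition mod \<open>q\<close> acts on \<open>[q]\<close>), and \<open>[q]\<^sup>T\<close> is the set \<open>T \<rightarrow>\<^sub>E {..<q}\<close> of
  extensional functions.\<close>

subsection \<open>Predicates and random instances\<close>

definition uniform_supporting :: "nat \<Rightarrow> nat \<Rightarrow> nat \<Rightarrow> ((nat \<Rightarrow> nat) \<Rightarrow> real) \<Rightarrow> bool" where
  "uniform_supporting q k s P \<longleftrightarrow>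
     (\<exists>\<mu> :: (nat \<Rightarrow> nat) pmf.
        set_pmf \<mu> \<subseteq> {z \<in> {..<k} \<rightarrow>\<^sub>E {..<q}. P z = 1} \<and>
        (\<forall>T \<alpha>. T \<subseteq> {..<k} \<and> 1 \<le> card T \<and> card T \<le> s \<and> \<alpha> \<in> T \<rightarrow>\<^sub>E {..<q} \<longrightarrow>
           measure_pmf.prob \<mu> {z. restrict z T = \<alpha>} = 1 / real q ^ card T))"

text \<open>A constraint is a pair \<open>(c, S)\<close> of shifts and variable indices.\<close>

type_synonym csp_constraint = "(nat \<Rightarrow> nat) \<times> (nat \<Rightarrow> nat)"

definition all_constraints :: "nat \<Rightarrow> nat \<Rightarrow> nat \<Rightarrow> csp_constraint set" where
  "all_constraints q k n = ({..<k} \<rightarrow>\<^sub>E {..<q}) \<times> ({..<k} \<rightarrow>\<^sub>E {..<n})"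

definition random_instance :: "nat \<Rightarrow> nat \<Rightarrow> nat \<Rightarrow> nat \<Rightarrow> csp_constraint multiset pmf" where
  "random_instance q k n m = map_pmf mset (replicate_pmf m (pmf_of_set (all_constraints q k n)))"

subsection \<open>Real polynomials in the variables \<open>x\<^sub>i\<^sub>,\<^sub>a\<close>\<close>

text \<open>The variable \<open>x\<^sub>i\<^sub>,\<^sub>a\<close> is indexed by the pair \<open>(i, a)\<close>; a monomial maps variables to exponents.\<close>

type_synonym monomial = "(nat \<times> nat) \<Rightarrow>\<^sub>0 nat"
type_synonym polynomial = "monomial \<Rightarrow>\<^sub>0 real"

definition const_poly :: "real \<Rightarrow> polynomial" where
  "const_poly a = Poly_Mapping.single 0 a"

definition var_poly :: "nat \<times> nat \<Rightarrow> polynomial" where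
  "var_poly v = Poly_Mapping.single (Poly_Mapping.single v 1) 1"

definition eval_poly :: "polynomial \<Rightarrow> (nat \<times> nat \<Rightarrow> real) \<Rightarrow> real" where
  "eval_poly p z =
     (\<Sum>w \<in> Poly_Mapping.keys p. Poly_Mapping.lookup p w *
        (\<Prod>v \<in> Poly_Mapping.keys w. z v ^ Poly_Mapping.lookup w v))"

text \<open>Reduction modulo \<open>x\<^sub>i\<^sub>,\<^sub>a\<^sup>2 = x\<^sub>i\<^sub>,\<^sub>a\<close>, collecting like monomials.\<close>

definition multilinear_form :: "polynomial \<Rightarrow> polynomial" where
  "multilinear_form p =
     (\<Sum>w \<in> Poly_Mapping.keys p.
        Poly_Mapping.single (\<Sum>v \<in> Poly_Mapping.keys w. Poly_Mapping.single v 1)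
          (Poly_Mapping.lookup p w))"

definition total_degree :: "polynomial \<Rightarrow> nat" where
  "total_degree p =
     Max (insert 0 ((\<lambda>w. \<Sum>v \<in> Poly_Mapping.keys w. Poly_Mapping.lookup w v) ` Poly_Mapping.keys p))"

definition multilinear_degree :: "polynomial \<Rightarrow> nat" where
  "multilinear_degree p = total_degree (multilinear_form p)"

definition involved_indices :: "polynomial \<Rightarrow> nat set" where
  "involved_indices p = fst ` (\<Union>w \<in> Poly_Mapping.keys p. Poly_Mapping.keys w)"

text \<open>\<open>P01\<close> is stated for polynomial arguments \<open>z\<close>, since it is only ever used after substituting
  the variables of a constraint.\<close>

definition P01 :: "nat \<Rightarrow> nat \<Rightarrow> ((nat \<Rightarrow> nat) \<Rightarrow> real) \<Rightarrow> (nat \<times> nat \<Rightarrow> polynomial) \<Rightarrow> polynomial" where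
  "P01 q k P z = (\<Sum>\<beta> \<in> {..<k} \<rightarrow>\<^sub>E {..<q}. const_poly (P \<beta>) * (\<Prod>j<k. z (j, \<beta> j)))"

definition shifted_vars :: "nat \<Rightarrow> csp_constraint \<Rightarrow> nat \<times> nat \<Rightarrow> polynomial" where
  "shifted_vars q C = (\<lambda>(j, a). var_poly (snd C j, (a + fst C j) mod q))"

text \<open>The set of left-hand sides \<open>p\<close> of the equations \<open>p = 1\<close> making up the system \<open>R\<^sub>I\<close>.\<close>

definition R_system :: "nat \<Rightarrow> nat \<Rightarrow> ((nat \<Rightarrow> nat) \<Rightarrow> real) \<Rightarrow> csp_constraint multiset \<Rightarrow> polynomial set" where
  "R_system q k P I = (\<lambda>C. P01 q k P (shifted_vars q C)) ` set_mset I"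

definition assignment_indicator :: "nat set \<Rightarrow> (nat \<Rightarrow> nat) \<Rightarrow> polynomial" where
  "assignment_indicator T \<alpha> = (\<Prod>i\<in>T. var_poly (i, \<alpha> i))"

subsection \<open>Sherali--Adams relaxations\<close>

type_synonym dist_family = "nat set \<Rightarrow> (nat \<Rightarrow> nat) pmf"

definition locally_consistent :: "nat \<Rightarrow> nat \<Rightarrow> nat \<Rightarrow> dist_family \<Rightarrow> bool" where
  "locally_consistent q n r D \<longleftrightarrow>
     D \<in> (\<Pi>\<^sub>E S \<in> {S. S \<subseteq> {..<n} \<and> card S \<le> r}. {\<nu>. set_pmf \<nu> \<subseteq> S \<rightarrow>\<^sub>E {..<q}}) \<and>
     (\<forall>S T. T \<subseteq> S \<and> S \<subseteq> {..<n} \<and> card S \<le> r \<longrightarrow> map_pmf (\<lambda>y. restrict y T) (D S) = D T)"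

definition encode :: "(nat \<Rightarrow> nat) \<Rightarrow> nat \<times> nat \<Rightarrow> real" where
  "encode y = (\<lambda>(i, a). if y i = a then 1 else 0)"

text \<open>Polynomials are read in multilinear form, in accordance with the use of multilinear degree.
  This matters only when monomials cancel in that form (for example when the product below reduces
  to \<open>0\<close>): the indices involved in the unreduced polynomial could then exceed \<open>r\<close> in number
  although its multilinear degree is at most \<open>r\<close>.\<close>

definition local_expectation :: "dist_family \<Rightarrow> polynomial \<Rightarrow> real" where
  "local_expectation D p =
     measure_pmf.expectation (D (involved_indices (multilinear_form p)))
       (\<lambda>y. eval_poly (multilinear_form p) (encode y))"

definition SA :: "nat \<Rightarrow> nat \<Rightarrow> nat \<Rightarrow> polynomial set \<Rightarrow> dist_family set" where
  "SA q n r R =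
     {D. locally_consistent q n r D \<and>
         (\<forall>p\<in>R. \<forall>T \<alpha>. T \<subseteq> {..<n} \<and> \<alpha> \<in> T \<rightarrow>\<^sub>E {..<q} \<and>
             multilinear_degree (assignment_indicator T \<alpha> * (p - 1)) \<le> r \<longrightarrow>
             local_expectation D (assignment_indicator T \<alpha> * (p - 1)) = 0)}"

text \<open>The index \<open>0\<close> of the moment matrix is \<open>None\<close>, the index \<open>(i, a)\<close> is \<open>Some (i, a)\<close>.\<close>

fun moment_matrix :: "dist_family \<Rightarrow> (nat \<times> nat) option \<Rightarrow> (nat \<times> nat) option \<Rightarrow> real" where
  "moment_matrix D None None = 1"
| "moment_matrix D None (Some (i, a)) = measure_pmf.prob (D {i}) {y. y i = a}"
| "moment_matrix D (Some (i, a)) None = measure_pmf.prob (D {i}) {y. y i = a}"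
| "moment_matrix D (Some (i, a)) (Some (j, b)) = measure_pmf.prob (D {i, j}) {y. y i = a \<and> y j = b}"

definition psd_matrix_on :: "'i set \<Rightarrow> ('i \<Rightarrow> 'i \<Rightarrow> real) \<Rightarrow> bool" where
  "psd_matrix_on J M \<longleftrightarrow>
     (\<forall>u\<in>J. \<forall>v\<in>J. M u v = M v u) \<and> (\<forall>f :: 'i \<Rightarrow> real. 0 \<le> (\<Sum>u\<in>J. \<Sum>v\<in>J. f u * M u v * f v))"

definition SA_plus :: "nat \<Rightarrow> nat \<Rightarrow> nat \<Rightarrow> polynomial set \<Rightarrow> dist_family set" where
  "SA_plus q n r R =
     {D \<in> SA q n r R. psd_matrix_on (insert None (Some ` ({..<n} \<times> {..<q}))) (moment_matrix D)}"

end

theory Submission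
  imports Defs "HOL-Real_Asymp.Real_Asymp"
begin

text \<open>With high probability the instance expands: every set of \<open>s\<close> constraints, \<open>s\<close> up to a large
  multiple of \<open>n powr (\<epsilon> / (t - 2))\<close>, has at least \<open>(k - t / 2 + \<delta>) s\<close> variables. This is a union
  bound over the slots that repeat the variable of another slot.

  For a constraint set \<open>B\<close> weight the uniform distribution on all assignments by the product of the
  local distributions \<open>\<mu>\<close> over \<open>B\<close>. Adding constraints to \<open>B\<close> does not change the marginal on a set \<open>S\<close>
  as long as they can be peeled off one by one, each having at most \<open>t - 1\<close> slots shared with the
  remaining ones, with \<open>B\<close> or with \<open>S\<close>. Expansion provides, for each small \<open>S\<close>, a small \<open>B\<close> such that
  every small set of further constraints can be peeled off. The resulting marginals on \<open>S\<close> do not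
  depend on the choice of \<open>B\<close>, hence are consistent, and satisfy every constraint on \<open>S\<close>.

  Eliminating the index \<open>0\<close>, the moment matrix is positive semidefinite iff the covariance matrix is.
  Again by expansion, each variable lies in a set of bounded size that is uncorrelated with its
  complement. So the covariance matrix splits into blocks, each the covariance matrix of an actual
  distribution.\<close>

subsection \<open>Fibres of restriction maps and block quadratic forms\<close>

text \<open>An extension of \<open>y\<close> to \<open>N\<close> is a free choice of values on
  \<open>N - A\<close>: restriction to \<open>N - A\<close> is inverted by gluing with
  \<open>y\<close>.\<close>

lemma card_PiE_fiber:
  assumes "finite N" "A \<subseteq> N" "y \<in> A \<rightarrow>\<^sub>E Q"
  shows "card {x \<in> N \<rightarrow>\<^sub>E Q. restrict x A = y} = card Q ^ card (N - A)"
proof -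
  have "bij_betw (\<lambda>x. restrict x (N - A)) {x \<in> N \<rightarrow>\<^sub>E Q. restrict x A = y} ((N - A) \<rightarrow>\<^sub>E Q)"
  proof (rule bij_betw_byWitness[where f' = "\<lambda>z i. if i \<in> A then y i else z i"])
    show "\<forall>x\<in>{x \<in> N \<rightarrow>\<^sub>E Q. restrict x A = y}.
        (\<lambda>i. if i \<in> A then y i else restrict x (N - A) i) = x"
      by (auto simp: fun_eq_iff PiE_def extensional_def)
    show "\<forall>z\<in>(N - A) \<rightarrow>\<^sub>E Q. restrict (\<lambda>i. if i \<in> A then y i else z i) (N - A) = z"
      by (auto simp: fun_eq_iff PiE_def extensional_def restrict_def)
    show "(\<lambda>x. restrict x (N - A)) ` {x \<in> N \<rightarrow>\<^sub>E Q. restrict x A = y} \<subseteq> (N - A) \<rightarrow>\<^sub>E Q"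
      by auto
    have "(\<lambda>i. if i \<in> A then y i else z i) \<in> {x \<in> N \<rightarrow>\<^sub>E Q. restrict x A = y}"
      if z: "z \<in> (N - A) \<rightarrow>\<^sub>E Q" for z
    proof -
      have "(\<lambda>i. if i \<in> A then y i else z i) \<in> N \<rightarrow>\<^sub>E Q"
        using z assms by (fastforce simp: PiE_iff extensional_def)
      moreover have "restrict (\<lambda>i. if i \<in> A then y i else z i) A = y"
        using assms by (auto simp: fun_eq_iff PiE_iff extensional_def)
      ultimately show ?thesis by simp
    qed
    then show "(\<lambda>z i. if i \<in> A then y i else z i) ` ((N - A) \<rightarrow>\<^sub>E Q)
        \<subseteq> {x \<in> N \<rightarrow>\<^sub>E Q. restrict x A = y}"
      by blast
  qed
  then show ?thesis
    using assms by (simp add: bij_betw_same_card card_PiE)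
qed

lemma mod_add_right_cancel_less:
  fixes a b d q :: nat
  assumes "a < q" "b < q" "(a + d) mod q = (b + d) mod q"
  shows "a = b"
proof -
  have "(int a + int d) mod int q = (int b + int d) mod int q"
    using assms(3) by (metis of_nat_add zmod_int)
  then have "int q dvd int a - int b"
    by (simp add: mod_eq_dvd_iff)
  then show ?thesis
    using assms(1,2) by (metis mod_eq_dvd_iff mod_less of_nat_eq_iff zmod_int)
qed

lemma finite_max_card:
  assumes "finite \<A>" "A \<in> \<A>"
  obtains B where "B \<in> \<A>" "\<And>B'. B' \<in> \<A> \<Longrightarrow> card B' \<le> card B"
proof -
  have "Max (card ` \<A>) \<in> card ` \<A>" using assms by (intro Max_in) auto
  then obtain B where "B \<in> \<A>" "Max (card ` \<A>) = card B" by auto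
  then show ?thesis using assms(1) that by (metis Max_ge finite_imageI imageI)
qed

text \<open>The sets \<open>K i\<close> may overlap, so they are removed one at a time: cut off
  \<open>C = K i \<inter> V\<close>, whose cross terms with the rest vanish, and recurse on the
  rest. A later block may have lost indices by then, hence \<open>block\<close> speaks of all
  subsets of \<open>K i \<inter> V\<close>.\<close>

lemma quadratic_form_nonneg_by_blocks:
  fixes T :: "'a \<Rightarrow> 'a \<Rightarrow> real"
  assumes "finite V"
    and mem: "\<And>i. i \<in> V \<Longrightarrow> i \<in> K i"
    and zero: "\<And>i i' j. i \<in> V \<Longrightarrow> i' \<in> V \<Longrightarrow> j \<in> V \<Longrightarrow> i' \<in> K i \<Longrightarrow> j \<notin> K i \<Longrightarrow>
                 T i' j = 0 \<and> T j i' = 0"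
    and block: "\<And>i C. i \<in> V \<Longrightarrow> C \<subseteq> K i \<inter> V \<Longrightarrow> 0 \<le> (\<Sum>a\<in>C. \<Sum>b\<in>C. T a b)"
  shows "0 \<le> (\<Sum>a\<in>V. \<Sum>b\<in>V. T a b)"
  using assms
proof (induction V rule: finite_psubset_induct)
  case (psubset V)
  show ?case
  proof (cases "V = {}")
    case False
    then obtain i where i: "i \<in> V" by blast
    define C where "C = K i \<inter> V"
    define R where "R = V - C"
    have split: "(\<Sum>a\<in>V. f a) = (\<Sum>a\<in>C. f a) + (\<Sum>a\<in>R. f a)" for f :: "'a \<Rightarrow> real"
      unfolding R_def using psubset.hyps
      by (subst sum.subset_diff[of C V]) (auto simp: C_def)
    have "R \<subset> V" using i psubset.prems(1)[OF i] by (auto simp: R_def C_def)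
    then have "0 \<le> (\<Sum>a\<in>R. \<Sum>b\<in>R. T a b)"
    proof (rule psubset.IH)
      show "i \<in> K i" if "i \<in> R" for i using that psubset.prems(1) by (auto simp: R_def)
      show "T i' j = 0 \<and> T j i' = 0"
        if "i \<in> R" "i' \<in> R" "j \<in> R" "i' \<in> K i" "j \<notin> K i" for i i' j
        using that by (intro psubset.prems(2)[of i]) (auto simp: R_def)
      show "0 \<le> (\<Sum>a\<in>C. \<Sum>b\<in>C. T a b)" if "i \<in> R" "C \<subseteq> K i \<inter> R" for i C
        using that by (intro psubset.prems(3)[of i]) (auto simp: R_def)
    qed
    moreover have "0 \<le> (\<Sum>a\<in>C. \<Sum>b\<in>C. T a b)"
      using i by (intro psubset.prems(3)[of i]) (auto simp: C_def)
    moreover have "T a b = 0" "T b a = 0" if "a \<in> C" "b \<in> R" for a b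
      using psubset.prems(2)[OF i, of a b] that by (auto simp: C_def R_def)
    then have "(\<Sum>a\<in>C. \<Sum>b\<in>R. T a b) = 0" "(\<Sum>a\<in>R. \<Sum>b\<in>C. T a b) = 0"
      by (simp_all add: sum.neutral)
    ultimately show ?thesis
      by (simp add: split sum.distrib)
  qed simp
qed

text \<open>The double sum is the variance of the sum of the \<open>h i\<close> over
  \<open>C\<close>.\<close>

lemma covariance_form_nonneg:
  fixes \<nu> :: "'y pmf" and h :: "'i \<Rightarrow> 'y \<Rightarrow> real"
  assumes "finite (set_pmf \<nu>)"
  shows "0 \<le> (\<Sum>i\<in>C. \<Sum>j\<in>C. measure_pmf.expectation \<nu> (\<lambda>y. h i y * h j y)
             - measure_pmf.expectation \<nu> (h i) * measure_pmf.expectation \<nu> (h j))"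
proof -
  let ?E = "measure_pmf.expectation \<nu>"
  have int: "integrable (measure_pmf \<nu>) f" for f :: "'y \<Rightarrow> real"
    using assms by (rule integrable_measure_pmf_finite)
  define H where "H y = (\<Sum>i\<in>C. h i y)" for y
  have "0 \<le> ?E (\<lambda>y. (H y - ?E H)\<^sup>2)"
    by (rule integral_nonneg_AE) simp
  also have "\<dots> = ?E (\<lambda>y. (H y)\<^sup>2) - (?E H)\<^sup>2"
    by (rule measure_pmf.variance_eq) (rule int)+
  also have "?E (\<lambda>y. (H y)\<^sup>2) = (\<Sum>i\<in>C. \<Sum>j\<in>C. ?E (\<lambda>y. h i y * h j y))"
    unfolding H_def power2_eq_square sum_product
    by (simp add: Bochner_Integration.integral_sum int)
  also have "?E H = (\<Sum>i\<in>C. ?E (h i))"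
    unfolding H_def by (simp add: Bochner_Integration.integral_sum int)
  finally show ?thesis
    by (simp add: power2_eq_square sum_product sum_subtractf)
qed

subsection \<open>Peeling off constraints\<close>

text \<open>Constraint number \<open>l\<close> has the variable \<open>v l j\<close>, shifted by \<open>c l j\<close>, in slot \<open>j\<close>. Constraints are
  told apart by their numbers, so repeated constraints and repeated variables within a constraint
  need no separate treatment.\<close>

locale csp_instance =
  fixes q k t n m :: nat and \<mu> :: "(nat \<Rightarrow> nat) pmf" and v c :: "nat \<Rightarrow> nat \<Rightarrow> nat"
  assumes q_pos: "0 < q"
    and v_less: "\<And>l j. l < m \<Longrightarrow> j < k \<Longrightarrow> v l j < n"
    and set_mu: "set_pmf \<mu> \<subseteq> {..<k} \<rightarrow>\<^sub>E {..<q}"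
    and mu_uniform: "\<And>T \<alpha>. T \<subseteq> {..<k} \<Longrightarrow> card T < t \<Longrightarrow> \<alpha> \<in> T \<rightarrow>\<^sub>E {..<q} \<Longrightarrow>
           measure_pmf.prob \<mu> {z. restrict z T = \<alpha>} = 1 / real q ^ card T"
begin

definition X :: "(nat \<Rightarrow> nat) set" where "X = {..<n} \<rightarrow>\<^sub>E {..<q}"

definition nbr :: "nat set \<Rightarrow> nat set" where "nbr F = (\<Union>l\<in>F. v l ` {..<k})"

text \<open>Slots are compared as pairs, so two slots of the same constraint in \<open>F\<close>
  that carry the same variable are both shared.\<close>

definition shared_slots :: "nat set \<Rightarrow> nat set \<Rightarrow> nat \<Rightarrow> nat set" where
  "shared_slots U F l =
     {j. j < k \<and> (v l j \<in> U \<or> (\<exists>l'\<in>F. \<exists>j'<k. (l', j') \<noteq> (l, j) \<and> v l' j' = v l j))}"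

text \<open>If \<open>F\<close> is not a core relative to \<open>U\<close>, some constraint of \<open>F\<close> has fewer than \<open>t\<close> slots whose
  variable occurs in \<open>U\<close> or in another slot of \<open>F\<close>. Summing out its remaining variables then turns
  its weight into a constant, because \<open>\<mu>\<close> is \<open>(t - 1)\<close>-wise uniform.\<close>

definition core :: "nat set \<Rightarrow> nat set \<Rightarrow> bool" where
  "core U F \<longleftrightarrow> (\<forall>l\<in>F. t \<le> card (shared_slots U F l))"

text \<open>The polynomial of a constraint selects the \<beta> with
  \<open>x (v l j) = (\<beta> j + c l j) mod q\<close>, so the predicate is applied to the
  assignment shifted back by \<open>c l\<close>. For \<open>c l j < q\<close>, adding
  \<open>q - c l j\<close> subtracts the shift without leaving the naturals.\<close>

definition view :: "nat \<Rightarrow> (nat \<Rightarrow> nat) \<Rightarrow> nat \<Rightarrow> nat" where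
  "view l x = (\<lambda>j\<in>{..<k}. (x (v l j) + (q - c l j)) mod q)"

text \<open>A density relative to the uniform distribution on \<open>X\<close>: the factor
  \<open>q ^ k\<close> gives a constraint on distinct variables mean 1.\<close>

definition W :: "nat set \<Rightarrow> (nat \<Rightarrow> nat) \<Rightarrow> real" where
  "W F x = (\<Prod>l\<in>F. real q ^ k * pmf \<mu> (view l x))"

definition depends_on :: "nat set \<Rightarrow> ((nat \<Rightarrow> nat) \<Rightarrow> real) \<Rightarrow> bool" where
  "depends_on U g \<longleftrightarrow> (\<forall>x\<in>X. \<forall>x'\<in>X. (\<forall>i\<in>U. x i = x' i) \<longrightarrow> g x = g x')"

section \<open>Dependence on variables, neighbourhoods and weights\<close>

lemma finite_X [simp]: "finite X"
  by (simp add: X_def finite_PiE)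

lemma card_X: "card X = q ^ n"
  by (simp add: X_def card_PiE)

lemma depends_on_mono: "depends_on U g \<Longrightarrow> U \<subseteq> U' \<Longrightarrow> depends_on U' g"
  unfolding depends_on_def by blast

text \<open>Elements of \<open>X\<close> are extensional, hence all agree outside
  \<open>{..<n}\<close>.\<close>

lemma depends_on_Int_range: "depends_on U g \<Longrightarrow> depends_on (U \<inter> {..<n}) g"
proof -
  assume g: "depends_on U g"
  have "g x = g x'" if x: "x \<in> X" "x' \<in> X" "\<forall>i\<in>U \<inter> {..<n}. x i = x' i" for x x'
  proof -
    have "x i = x' i" if "i \<in> U" for i
      using x that by (cases "i < n") (auto simp: X_def PiE_def extensional_def)
    then show ?thesis using g x(1,2) unfolding depends_on_def by blast
  qed
  then show ?thesis unfolding depends_on_def by blast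
qed

lemma depends_on_mult: "depends_on U g \<Longrightarrow> depends_on U h \<Longrightarrow> depends_on U (\<lambda>x. g x * h x)"
  unfolding depends_on_def by metis

lemma depends_on_W: "depends_on (nbr F) (W F)"
proof -
  have "W F x = W F x'" if "\<forall>i\<in>nbr F. x i = x' i" for x x'
  proof -
    have "view l x = view l x'" if "l \<in> F" for l
      using that \<open>\<forall>i\<in>nbr F. x i = x' i\<close> by (auto simp: view_def nbr_def fun_eq_iff)
    then show ?thesis
      unfolding W_def by (intro prod.cong) auto
  qed
  then show ?thesis
    unfolding depends_on_def by blast
qed

lemma nbr_Un: "nbr (A \<union> B) = nbr A \<union> nbr B"
  by (auto simp: nbr_def)

lemma finite_nbr: "finite F \<Longrightarrow> finite (nbr F)"
  by (auto simp: nbr_def)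

lemma nbr_subset: "F \<subseteq> {..<m} \<Longrightarrow> nbr F \<subseteq> {..<n}"
  using v_less by (fastforce simp: nbr_def)

lemma card_nbr_le: "finite F \<Longrightarrow> card (nbr F) \<le> k * card F"
proof -
  assume "finite F"
  then have "card (nbr F) \<le> (\<Sum>l\<in>F. card (v l ` {..<k}))"
    unfolding nbr_def by (rule card_UN_le)
  also have "\<dots> \<le> (\<Sum>l\<in>F. k)"
    by (intro sum_mono) (metis card_image_le card_lessThan finite_lessThan)
  finally show ?thesis by (simp add: mult.commute)
qed

lemma W_Un: "finite A \<Longrightarrow> finite B \<Longrightarrow> A \<inter> B = {} \<Longrightarrow> W (A \<union> B) x = W A x * W B x"
  by (simp add: W_def prod.union_disjoint)

lemma W_nonneg: "0 \<le> W F x"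
  by (simp add: W_def prod_nonneg)

text \<open>Group the assignments by their values off the variables of the slots in
  \<open>J\<close>. Within a group \<open>h\<close> is constant and \<open>view l\<close> runs
  bijectively through the tuples with prescribed entries outside \<open>J\<close>. So the weights
  add up to a marginal of \<mu> on fewer than \<open>t\<close> slots, which is uniform.\<close>

lemma sum_single_constraint:
  assumes l: "l < m" and J: "J \<subseteq> {..<k}" "card ({..<k} - J) < t"
    and priv: "\<And>j j'. j \<in> J \<Longrightarrow> j' < k \<Longrightarrow> v l j' = v l j \<Longrightarrow> j' = j"
    and h: "depends_on ({..<n} - v l ` J) h"
  shows "(\<Sum>x\<in>X. h x * (real q ^ k * pmf \<mu> (view l x))) = (\<Sum>x\<in>X. h x)"
proof -
  define A where "A = {..<n} - v l ` J"
  define Fi where "Fi y = {x \<in> X. restrict x A = y}" for y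
  have finJ: "finite J" using J finite_subset by blast
  have inj: "inj_on (v l) J"
    using priv J by (intro inj_onI) auto
  have vJ: "v l ` J \<subseteq> {..<n}" using v_less[OF l] J by auto
  have group: "(\<Sum>x\<in>X. f x) = (\<Sum>y\<in>A \<rightarrow>\<^sub>E {..<q}. \<Sum>x\<in>Fi y. f x)" for f :: "_ \<Rightarrow> real"
    unfolding Fi_def
  proof (rule sum.group[symmetric])
    show "(\<lambda>x. restrict x A) ` X \<subseteq> A \<rightarrow>\<^sub>E {..<q}"
      by (auto simp: X_def A_def PiE_iff)
  qed (simp_all add: finite_PiE A_def)
  have main: "(\<Sum>x\<in>Fi y. h x * (real q ^ k * pmf \<mu> (view l x))) = (\<Sum>x\<in>Fi y. h x)"
    if y: "y \<in> A \<rightarrow>\<^sub>E {..<q}" for y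
  proof (cases "Fi y = {}")
    case False
    then obtain x0 where x0: "x0 \<in> Fi y" by blast
    define K where "K = {..<k} - J"
    define \<alpha> where "\<alpha> = restrict (view l x0) K"
    define Z where "Z = {z \<in> {..<k} \<rightarrow>\<^sub>E {..<q}. restrict z K = \<alpha>}"
    have agree: "x i = x' i" if "x \<in> Fi y" "x' \<in> Fi y" "i \<in> A" for x x' i
      using that by (auto simp: Fi_def) (metis restrict_apply')
    have hconst: "h x = h x0" if "x \<in> Fi y" for x
    proof -
      have "\<forall>i\<in>{..<n} - v l ` J. x i = x0 i"
        using agree[OF that x0] by (simp add: A_def)
      then show ?thesis
        using h that x0 unfolding depends_on_def Fi_def by blast
    qed
    have cardFi: "card (Fi y) = q ^ card J"
    proof -
      have "{..<n} - A = v l ` J" using vJ by (auto simp: A_def)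
      then show ?thesis
        using card_PiE_fiber[of "{..<n}" A y "{..<q}"] y inj
        by (simp add: Fi_def X_def A_def card_image)
    qed
    have \<alpha>: "\<alpha> \<in> K \<rightarrow>\<^sub>E {..<q}"
      unfolding \<alpha>_def restrict_PiE_iff using q_pos by (simp add: view_def K_def)
    have cardZ: "card Z = q ^ card J"
    proof -
      have "{..<k} - K = J" using J by (auto simp: K_def)
      then show ?thesis
        using card_PiE_fiber[of "{..<k}" K \<alpha> "{..<q}"] \<alpha>
        by (simp add: Z_def K_def)
    qed
    have sub: "view l ` Fi y \<subseteq> Z"
    proof
      fix z assume "z \<in> view l ` Fi y"
      then obtain x where x: "x \<in> Fi y" "z = view l x" by blast
      have "x (v l j) = x0 (v l j)" if "j \<in> K" for j
      proof (rule agree[OF x(1) x0])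
        have "j < k" "j \<notin> J" using that by (auto simp: K_def)
        then have "v l j \<notin> v l ` J" using priv by auto
        then show "v l j \<in> A" using v_less[OF l \<open>j < k\<close>] by (simp add: A_def)
      qed
      then have "restrict z K = \<alpha>"
        by (auto simp: x(2) \<alpha>_def view_def restrict_def fun_eq_iff)
      moreover have "z \<in> {..<k} \<rightarrow>\<^sub>E {..<q}"
        using q_pos by (auto simp: x(2) view_def)
      ultimately show "z \<in> Z" by (simp add: Z_def)
    qed
    have injv: "inj_on (view l) (Fi y)"
    proof (rule inj_onI)
      fix x x' assume x: "x \<in> Fi y" "x' \<in> Fi y" and eq: "view l x = view l x'"
      show "x = x'"
      proof
        fix i
        consider "i \<in> A" | "i \<in> v l ` J" | "i \<notin> {..<n}" by (auto simp: A_def)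
        then show "x i = x' i"
        proof cases
          case 1 then show ?thesis using agree x by blast
        next
          case 2
          then obtain j where j: "j \<in> J" "i = v l j" by blast
          then have "j < k" using J by auto
          have "view l x j = view l x' j" using eq by simp
          then have "(x i + (q - c l j)) mod q = (x' i + (q - c l j)) mod q"
            using \<open>j < k\<close> j by (simp add: view_def)
          moreover have "x i < q" "x' i < q"
            using x 2 vJ by (auto simp: Fi_def X_def PiE_iff)
          ultimately show ?thesis using mod_add_right_cancel_less by blast
        next
          case 3 then show ?thesis using x by (auto simp: Fi_def X_def PiE_def extensional_def)
        qed
      qed
    qed
    have finZ: "finite Z" unfolding Z_def by (simp add: finite_PiE)
    \<comment> \<open>An injection between finite sets of the same size \<open>q ^ card J\<close> is
      onto.\<close>
    have img: "view l ` Fi y = Z"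
      using card_subset_eq[OF finZ sub] cardFi cardZ card_image[OF injv] by simp
    have "(\<Sum>x\<in>Fi y. pmf \<mu> (view l x)) = (\<Sum>z\<in>Z. pmf \<mu> z)"
      using sum.reindex[OF injv, of "pmf \<mu>"] by (simp add: img)
    also have "\<dots> = measure_pmf.prob \<mu> Z"
      by (simp add: measure_measure_pmf_finite finZ)
    also have "\<dots> = measure_pmf.prob \<mu> {z. restrict z K = \<alpha>}"
      using set_mu by (intro measure_pmf.finite_measure_eq_AE)
        (auto simp: Z_def AE_measure_pmf_iff)
    also have "\<dots> = 1 / real q ^ card K"
      using J \<alpha> by (intro mu_uniform) (auto simp: K_def)
    finally have S: "(\<Sum>x\<in>Fi y. pmf \<mu> (view l x)) = 1 / real q ^ card K" .
    have kJ: "k = card K + card J"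
      using J finJ card_Diff_subset[OF finJ J(1)] card_mono[OF _ J(1)] by (simp add: K_def)
    have "(\<Sum>x\<in>Fi y. h x * (real q ^ k * pmf \<mu> (view l x)))
        = (\<Sum>x\<in>Fi y. h x0 * real q ^ k * pmf \<mu> (view l x))"
      using hconst by (intro sum.cong) auto
    also have "\<dots> = h x0 * real q ^ k * (1 / real q ^ card K)"
      by (simp add: sum_distrib_left[symmetric] S)
    also have "\<dots> = h x0 * real q ^ card J"
      using q_pos by (subst kJ) (simp add: power_add)
    also have "\<dots> = (\<Sum>x\<in>Fi y. h x)"
      using hconst by (simp add: cardFi)
    finally show ?thesis .
  qed simp
  show ?thesis
    unfolding group by (intro sum.cong refl main)
qed

text \<open>Remove a constraint \<open>l\<close> of \<open>F\<close> with fewer than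
  \<open>t\<close> shared slots: neither \<open>g\<close> nor the weight of the remaining
  constraints depends on the variables of its other slots, so \<open>sum_single_constraint\<close>
  deletes its factor. The hypothesis on all subsets passes to \<open>F - {l}\<close>.\<close>

lemma sum_extension:
  assumes "finite F" "F \<subseteq> {..<m}"
    and "\<And>F'. F' \<subseteq> F \<Longrightarrow> F' \<noteq> {} \<Longrightarrow> \<not> core U F'"
    and g: "depends_on U g"
  shows "(\<Sum>x\<in>X. g x * W F x) = (\<Sum>x\<in>X. g x)"
  using assms(1-3)
proof (induction F rule: finite_psubset_induct)
  case (psubset F)
  show ?case
  proof (cases "F = {}")
    case False
    then obtain l where l: "l \<in> F" and few: "card (shared_slots U F l) < t"
      using psubset.prems(2)[of F] by (auto simp: core_def not_le)
    define J where "J = {..<k} - shared_slots U F l"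
    have IH: "(\<Sum>x\<in>X. g x * W (F - {l}) x) = (\<Sum>x\<in>X. g x)"
      using psubset l by (intro psubset.IH) auto
    have "{..<k} - J = shared_slots U F l"
      by (auto simp: J_def shared_slots_def)
    moreover have "depends_on ({..<n} - v l ` J) (\<lambda>x. g x * W (F - {l}) x)"
    proof (rule depends_on_mult)
      have "U \<inter> {..<n} \<subseteq> {..<n} - v l ` J"
        by (auto simp: J_def shared_slots_def)
      then show "depends_on ({..<n} - v l ` J) g"
        using depends_on_mono[OF depends_on_Int_range[OF g]] by blast
      have "nbr (F - {l}) \<inter> {..<n} \<subseteq> {..<n} - v l ` J"
        unfolding nbr_def J_def shared_slots_def by force
      then show "depends_on ({..<n} - v l ` J) (W (F - {l}))"
        using depends_on_mono[OF depends_on_Int_range[OF depends_on_W]] by blast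
    qed
    moreover have "j' = j" if "j \<in> J" "j' < k" "v l j' = v l j" for j j'
      using that l unfolding J_def shared_slots_def by force
    ultimately have "(\<Sum>x\<in>X. (g x * W (F - {l}) x) * (real q ^ k * pmf \<mu> (view l x)))
        = (\<Sum>x\<in>X. g x * W (F - {l}) x)"
      using l few psubset.prems(1) by (intro sum_single_constraint[of l J]) (auto simp: J_def)
    moreover have "W F x = W (F - {l}) x * (real q ^ k * pmf \<mu> (view l x))" for x
      unfolding W_def using psubset.hyps l by (subst prod.remove[of F l]) auto
    ultimately show ?thesis using IH by (simp add: mult.assoc)
  qed (simp add: W_def)
qed

text \<open>Functions of disjoint sets of variables are independent under the uniform distribution.
  The involution of \<open>X \<times> X\<close> that exchanges the coordinates outside
  \<open>G\<close> turns \<open>g x * h y\<close> into \<open>g u * h u\<close>; the second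
  component is then free and contributes \<open>q ^ n\<close>.\<close>

lemma sum_mult_independent:
  assumes g: "depends_on G g" and h: "depends_on H h" and disj: "G \<inter> H = {}"
  shows "(\<Sum>x\<in>X. g x) * (\<Sum>x\<in>X. h x) = real q ^ n * (\<Sum>x\<in>X. g x * h x)"
proof -
  define mix where "mix x y = (\<lambda>i. if i \<in> G then x i else y i)" for x y :: "nat \<Rightarrow> nat"
  define sw where "sw = (\<lambda>(x, y). (mix x y, mix y x))"
  have mixX: "mix x y \<in> X" if "x \<in> X" "y \<in> X" for x y
    using that by (auto simp: mix_def X_def PiE_iff extensional_def)
  have "bij_betw sw (X \<times> X) (X \<times> X)"
    by (rule bij_betw_byWitness[where f' = sw])
       (auto simp: sw_def mixX, auto simp: mix_def fun_eq_iff)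
  then have "(\<Sum>p\<in>X \<times> X. (\<lambda>(u, _). g u * h u) (sw p)) = (\<Sum>p\<in>X \<times> X. (\<lambda>(u, _). g u * h u) p)"
    by (rule sum.reindex_bij_betw)
  moreover have "(\<lambda>(u, _). g u * h u) (sw (x, y)) = g x * h y" if "x \<in> X" "y \<in> X" for x y
  proof -
    have "g (mix x y) = g x"
    proof -
      have "\<forall>i\<in>G. mix x y i = x i" by (auto simp: mix_def)
      then show ?thesis using g mixX that unfolding depends_on_def by blast
    qed
    moreover have "h (mix x y) = h y"
    proof -
      have "\<forall>i\<in>H. mix x y i = y i" using disj by (auto simp: mix_def)
      then show ?thesis using h mixX that unfolding depends_on_def by blast
    qed
    ultimately show ?thesis by (simp add: sw_def)
  qed
  then have "(\<Sum>p\<in>X \<times> X. (\<lambda>(u, _). g u * h u) (sw p)) = (\<Sum>(x, y)\<in>X \<times> X. g x * h y)"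
    by (intro sum.cong) auto
  ultimately have "(\<Sum>(x, y)\<in>X \<times> X. g x * h y) = (\<Sum>(u, _)\<in>X \<times> X. g u * h u)"
    by simp
  then show ?thesis
    unfolding sum_product
    by (simp add: sum.cartesian_product[symmetric] card_X sum_distrib_left)
qed

text \<open>A variable outside \<open>U\<close> either fills a slot shared with nothing else, or at least two slots.\<close>

lemma core_slot_count:
  assumes F: "finite F" and core: "core U F"
  shows "2 * card (nbr F - U) + t * card F + card {(l, j) \<in> F \<times> {..<k}. v l j \<in> U}
           \<le> 2 * (k * card F)"
proof -
  define A where "A = F \<times> {..<k}"
  define f where "f = (\<lambda>(l, j). v l j)"
  define B where "B = {s \<in> A. f s \<in> U}"
  define N where "N = (SIGMA l:F. shared_slots U F l)"
  have finA: "finite A" using F by (simp add: A_def)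
  have cardA: "card A = k * card F" by (simp add: A_def card_cartesian_product)
  have NA: "N \<subseteq> A" by (auto simp: N_def A_def shared_slots_def)
  have "card N = (\<Sum>l\<in>F. card (shared_slots U F l))"
    unfolding N_def using F by (intro card_SigmaI) (auto simp: shared_slots_def)
  also have "\<dots> \<ge> (\<Sum>l\<in>F. t)"
    using core by (intro sum_mono) (auto simp: core_def)
  finally have cN: "t * card F \<le> card N" by (simp add: mult.commute)
  \<comment> \<open>\<open>a y\<close> counts all slots of \<open>F\<close> that carry
    \<open>y\<close>, and \<open>b y\<close> only the unshared ones.\<close>
  define a where "a y = card {s \<in> A. f s = y}" for y
  define b where "b y = card {s \<in> A - N. f s = y}" for y
  have ab: "2 \<le> a y + b y" if y: "y \<in> nbr F - U" for y
  proof -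
    from y obtain l j where lj: "l \<in> F" "j < k" "y = v l j" by (auto simp: nbr_def)
    have fin: "finite {s \<in> A. f s = y}" "finite {s \<in> A - N. f s = y}" using finA by auto
    show ?thesis
    proof (cases "(l, j) \<in> N")
      case True
      then obtain l' j' where l': "l' \<in> F" "j' < k" "(l', j') \<noteq> (l, j)" "v l' j' = v l j"
        using y lj by (auto simp: N_def shared_slots_def)
      then have "{(l, j), (l', j')} \<subseteq> {s \<in> A. f s = y}"
        using lj by (auto simp: A_def f_def)
      then have "card {(l, j), (l', j')} \<le> a y"
        unfolding a_def using fin card_mono by blast
      moreover have "card {(l, j), (l', j')} = 2"
        using l'(3) by (metis card_2_iff)
      ultimately show ?thesis by simp
    next
      case False
      then have "(l, j) \<in> {s \<in> A. f s = y}" "(l, j) \<in> {s \<in> A - N. f s = y}"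
        using lj by (auto simp: A_def f_def)
      then have "0 < a y" "0 < b y"
        unfolding a_def b_def using fin card_gt_0_iff by blast+
      then show ?thesis by simp
    qed
  qed
  have fn: "finite (nbr F - U)" using finite_nbr[OF F] by simp
  \<comment> \<open>Summing over the fibres of \<open>f\<close> counts each slot of \<open>C\<close>
    whose variable lies outside \<open>U\<close> once.\<close>
  have count: "(\<Sum>y\<in>nbr F - U. card {s \<in> C. f s = y}) = card (C - B)"
    if "C \<subseteq> A" for C
  proof -
    have "card (C - B) = (\<Sum>y\<in>nbr F - U. card {s \<in> C - B. f s = y})"
    proof -
      have "f ` (C - B) \<subseteq> nbr F - U"
        using that by (auto simp: B_def A_def f_def nbr_def)
      moreover have "finite (C - B)"
        using that finA finite_subset by blast
      ultimately show ?thesis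
        using sum.group[of "C - B" "nbr F - U" f "\<lambda>_. 1::nat"] fn
        by (simp only: card_eq_sum)
    qed
    also have "\<dots> = (\<Sum>y\<in>nbr F - U. card {s \<in> C. f s = y})"
      using that by (intro sum.cong arg_cong[where f = card]) (auto simp: B_def)
    finally show ?thesis by simp
  qed
  \<comment> \<open>Twice the number of new variables is at most the number of slots over variables
    outside \<open>U\<close> plus the number of unshared slots.\<close>
  have "2 * card (nbr F - U) = (\<Sum>y\<in>nbr F - U. 2)" by simp
  also have "\<dots> \<le> (\<Sum>y\<in>nbr F - U. a y + b y)"
    using ab by (rule sum_mono)
  also have "\<dots> = card (A - B) + card (A - N - B)"
    unfolding sum.distrib a_def b_def by (subst (1 2) count) auto
  also have "\<dots> \<le> card (A - B) + card (A - N)"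
    using finA by (simp add: card_mono)
  also have "\<dots> = (card A - card B) + (card A - card N)"
    using finA NA finite_subset[OF NA] by (simp add: card_Diff_subset B_def)
  finally have "2 * card (nbr F - U) \<le> (card A - card B) + (card A - card N)" .
  moreover have "card B \<le> card A" "card N \<le> card A"
    using finA NA by (auto simp: B_def intro: card_mono)
  moreover have "B = {(l, j) \<in> F \<times> {..<k}. v l j \<in> U}"
    by (auto simp: B_def A_def f_def)
  ultimately show ?thesis using cN cardA by simp
qed

text \<open>Enlarging \<open>F\<close> only adds partners for its slots. For \<open>l\<close> in
  \<open>F'\<close> but not in \<open>F\<close>, a slot meeting \<open>nbr F\<close> shares its
  variable with a slot of \<open>F\<close>, which is a different slot because \<open>l\<close> is
  not in \<open>F\<close>.\<close>

lemma core_Un: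
  assumes "core U F" "core (U \<union> nbr F) F'"
  shows "core U (F \<union> F')"
  unfolding core_def
proof
  fix l assume "l \<in> F \<union> F'"
  have fin: "finite (shared_slots U (F \<union> F') l)" by (simp add: shared_slots_def)
  show "t \<le> card (shared_slots U (F \<union> F') l)"
  proof (cases "l \<in> F")
    case True
    have "shared_slots U F l \<subseteq> shared_slots U (F \<union> F') l"
      by (auto simp: shared_slots_def)
    then show ?thesis
      using True assms(1) card_mono[OF fin] unfolding core_def by (meson le_trans)
  next
    case False
    then have "l \<in> F'" using \<open>l \<in> F \<union> F'\<close> by blast
    have "shared_slots (U \<union> nbr F) F' l \<subseteq> shared_slots U (F \<union> F') l"
      using False unfolding shared_slots_def nbr_def by fastforce
    then show ?thesis
      using \<open>l \<in> F'\<close> assms(2) card_mono[OF fin] unfolding core_def by (meson le_trans)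
  qed
qed

end

subsection \<open>Local distributions of an expanding instance\<close>

text \<open>A core relative to the empty set loses at least \<open>t / 2\<close> variables per
  constraint, more than expansion permits. The bound \<open>2 * L\<close> leaves room for the union
  of two sets of at most \<open>L\<close> constraints.\<close>

locale expanding_instance = csp_instance +
  fixes L :: nat and \<delta> :: real
  assumes delta_pos: "0 < \<delta>"
    and expansion: "\<And>F. F \<subseteq> {..<m} \<Longrightarrow> F \<noteq> {} \<Longrightarrow> card F \<le> 2 * L \<Longrightarrow>
           real k * card F - card (nbr F) \<le> (real t / 2 - \<delta>) * card F"
begin

text \<open>The last condition is what \<open>sum_extension\<close> requires of further constraints:
  adding at most \<open>L\<close> of them to \<open>B\<close> leaves the marginal on
  \<open>S\<close> unchanged.\<close>

definition good :: "nat set \<Rightarrow> nat set \<Rightarrow> bool" where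
  "good S B \<longleftrightarrow> B \<subseteq> {..<m} \<and> card B \<le> L \<and>
     (\<forall>F. F \<subseteq> {..<m} - B \<and> F \<noteq> {} \<and> card F \<le> L \<longrightarrow> \<not> core (S \<union> nbr B) F)"

text \<open>By \<open>dense\<close>, the set loses at least \<open>t / 2\<close> variables per
  constraint, apart from at most \<open>card U\<close> variables hidden in \<open>U\<close>.
  Expansion permits a loss of \<open>t / 2 - \<delta>\<close> only, so \<open>U\<close> has to pay
  for the remaining \<delta> per constraint.\<close>

lemma dense_card_bound:
  assumes F: "F \<subseteq> {..<m}" "card F \<le> 2 * L" and U: "finite U"
    and dense: "2 * card (nbr F - U) + t * card F \<le> 2 * (k * card F)"
  shows "\<delta> * card F \<le> card U"
proof (cases "F = {}")
  case False
  have finF: "finite F" using F finite_subset by blast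
  have "real (card (nbr F)) \<le> card (nbr F - U) + card U"
    using diff_card_le_card_Diff[OF U, of "nbr F"] by linarith
  moreover have "2 * real (card (nbr F - U)) + real t * card F \<le> 2 * (real k * card F)"
    using of_nat_mono[OF dense, where 'a = real] by simp
  moreover have "real k * card F - card (nbr F) \<le> (real t / 2 - \<delta>) * card F"
    using expansion F False by blast
  ultimately show ?thesis by (simp add: algebra_simps)
qed simp

text \<open>A core of maximal size does it: by expansion it is small, and a further core beyond it could be
  merged into it.\<close>

lemma ex_good:
  assumes B: "B \<subseteq> {..<m}" and U: "finite S"
    and small: "real (card B) + card (S \<union> nbr B) / \<delta> \<le> L"
  obtains F where "F \<subseteq> {..<m} - B" "card F \<le> L" "core (S \<union> nbr B) F" "good S (B \<union> F)"
proof -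
  define U where "U = S \<union> nbr B"
  have finB: "finite B" using B finite_subset by blast
  have finU: "finite U" using U finite_nbr[OF finB] by (simp add: U_def)
  \<comment> \<open>The limit is \<open>2 * L\<close>, although the maximal member will have at most
    \<open>L\<close> elements: its union with a further core of size at most \<open>L\<close> must
    compete.\<close>
  define \<F> where "\<F> = {F. F \<subseteq> {..<m} - B \<and> core U F \<and> card F \<le> 2 * L}"
  have "finite \<F>" unfolding \<F>_def by (rule finite_subset[of _ "Pow {..<m}"]) auto
  moreover have "{} \<in> \<F>" by (simp add: \<F>_def core_def)
  ultimately obtain F where F: "F \<in> \<F>" and max: "\<And>F'. F' \<in> \<F> \<Longrightarrow> card F' \<le> card F"
    by (rule finite_max_card) blast
  have finF: "finite F" using F finite_subset[of F "{..<m}"] by (auto simp: \<F>_def)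
  have "\<delta> * card F \<le> card U"
    using F core_slot_count[OF finF, of U] finU by (intro dense_card_bound) (auto simp: \<F>_def)
  then have "card F \<le> card U / \<delta>"
    using delta_pos by (simp add: field_simps)
  then have cF: "real (card B) + card F \<le> L" using small by (simp add: U_def)
  have "\<not> core (S \<union> nbr (B \<union> F)) F'"
    if F': "F' \<subseteq> {..<m} - (B \<union> F)" "F' \<noteq> {}" "card F' \<le> L" for F'
  proof
    assume c: "core (S \<union> nbr (B \<union> F)) F'"
    have finF': "finite F'" using F'(1) finite_subset[of F' "{..<m}"] by auto
    have disj: "F \<inter> F' = {}" using F' by auto
    have "core U (F \<union> F')"
      using F c by (intro core_Un) (auto simp: \<F>_def U_def nbr_Un Un_assoc)
    moreover have card: "card (F \<union> F') = card F + card F'"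
      using disj finF finF' by (rule card_Un_disjoint[rotated 2])
    ultimately have "F \<union> F' \<in> \<F>"
      using F F' cF by (auto simp: \<F>_def)
    then have "card F + card F' \<le> card F" using max card by metis
    then show False using finF' F'(2) by simp
  qed
  moreover have "card (B \<union> F) \<le> L"
    using card_Un_le[of B F] cF by linarith
  ultimately have "good S (B \<union> F)"
    using B F by (auto simp: good_def \<F>_def)
  then show ?thesis
    using F cF by (intro that[of F]) (auto simp: \<F>_def U_def)
qed

text \<open>No nonempty subset of \<open>F - B\<close> is a core relative to
  \<open>S \<union> nbr B\<close>, so \<open>F - B\<close> can be summed out with
  \<open>g x * W B x\<close> in the role of the test function.\<close>

lemma sum_good_extend:
  assumes B: "good S B" and F: "F \<subseteq> {..<m}" "card F \<le> L" and g: "depends_on S g"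
  shows "(\<Sum>x\<in>X. g x * W (B \<union> F) x) = (\<Sum>x\<in>X. g x * W B x)"
proof -
  have fin: "finite B" "finite F"
    using B F finite_subset by (auto simp: good_def)
  have "(\<Sum>x\<in>X. (g x * W B x) * W (F - B) x) = (\<Sum>x\<in>X. g x * W B x)"
  proof (rule sum_extension)
    show "\<not> core (S \<union> nbr B) F'" if "F' \<subseteq> F - B" "F' \<noteq> {}" for F'
    proof -
      have "F' \<subseteq> F" using that by blast
      then have "card F' \<le> L"
        using card_mono[OF fin(2)] F(2) le_trans by blast
      then show ?thesis
        using B that F unfolding good_def by blast
    qed
    show "depends_on (S \<union> nbr B) (\<lambda>x. g x * W B x)"
      by (intro depends_on_mult depends_on_mono[OF g] depends_on_mono[OF depends_on_W]) auto
  qed (use fin F in auto)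
  moreover have "W (B \<union> F) x = W B x * W (F - B) x" for x
    using W_Un[of B "F - B" x] fin by (simp add: Un_Diff_cancel)
  ultimately show ?thesis by (simp add: mult.assoc)
qed

text \<open>Both sides equal the sum with the weight of \<open>B \<union> B'\<close>.\<close>

lemma sum_good_agree:
  assumes "good S B" "good S' B'" "depends_on S g" "depends_on S' g"
  shows "(\<Sum>x\<in>X. g x * W B x) = (\<Sum>x\<in>X. g x * W B' x)"
proof -
  have "B \<subseteq> {..<m}" "card B \<le> L" "B' \<subseteq> {..<m}" "card B' \<le> L"
    using assms by (auto simp: good_def)
  then show ?thesis
    using sum_good_extend[of S B B' g] sum_good_extend[of S' B' B g] assms
    by (simp add: Un_commute)
qed

text \<open>With no variables given, the slot count of a core and expansion force
  \<open>\<delta> * card F \<le> 0\<close>. This provides the normalisation of the weights.\<close>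

lemma good_empty: "good {} {}"
proof -
  have "\<not> core {} F" if F: "F \<subseteq> {..<m}" "F \<noteq> {}" "card F \<le> L" for F
  proof
    assume "core {} F"
    have finF: "finite F" using F finite_subset by blast
    have "\<delta> * card F \<le> card ({} :: nat set)"
      using core_slot_count[OF finF \<open>core {} F\<close>] F by (intro dense_card_bound) auto
    then show False
      using finF F(2) delta_pos by (simp add: mult_le_0_iff)
  qed
  then show ?thesis by (simp add: good_def nbr_def)
qed

text \<open>A set of at most \<open>L\<close> constraints can be peeled off completely from the
  constant function 1.\<close>

lemma sum_W:
  assumes "B \<subseteq> {..<m}" "card B \<le> L"
  shows "(\<Sum>x\<in>X. W B x) = real q ^ n"
  using sum_good_extend[OF good_empty assms, of "\<lambda>_. 1"]
  by (simp add: depends_on_def card_X W_def)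

section \<open>Probability distributions with density \<open>W B\<close>\<close>

definition density_pmf :: "nat set \<Rightarrow> (nat \<Rightarrow> nat) pmf" where
  "density_pmf B = embed_pmf (\<lambda>x. if x \<in> X then W B x / real q ^ n else 0)"

lemma pmf_density:
  assumes "B \<subseteq> {..<m}" "card B \<le> L"
  shows "pmf (density_pmf B) x = (if x \<in> X then W B x / real q ^ n else 0)"
  unfolding density_pmf_def
proof (rule pmf_embed_pmf)
  let ?f = "\<lambda>x. if x \<in> X then W B x / real q ^ n else 0"
  show "0 \<le> ?f x" for x using W_nonneg by simp
  have "(\<integral>\<^sup>+x. ennreal (?f x) \<partial>count_space UNIV) = (\<integral>\<^sup>+x. ennreal (?f x) \<partial>count_space X)"
    by (rule nn_integral_count_space_eq) auto
  also have "\<dots> = (\<Sum>x\<in>X. ennreal (?f x))"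
    by (simp add: nn_integral_count_space_finite)
  also have "\<dots> = ennreal (\<Sum>x\<in>X. W B x / real q ^ n)"
    by (subst sum_ennreal[symmetric]) (auto simp: W_nonneg)
  also have "(\<Sum>x\<in>X. W B x / real q ^ n) = 1"
    using sum_W[OF assms] q_pos by (simp add: sum_divide_distrib[symmetric])
  finally show "(\<integral>\<^sup>+x. ennreal (?f x) \<partial>count_space UNIV) = 1" by simp
qed

lemma set_density: "B \<subseteq> {..<m} \<Longrightarrow> card B \<le> L \<Longrightarrow> set_pmf (density_pmf B) \<subseteq> X"
  by (auto simp: set_pmf_eq pmf_density)

lemma prob_density:
  assumes "B \<subseteq> {..<m}" "card B \<le> L"
  shows "measure_pmf.prob (density_pmf B) A = (\<Sum>x\<in>X. of_bool (x \<in> A) * W B x) / real q ^ n"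
proof -
  have "measure_pmf.prob (density_pmf B) A = measure_pmf.prob (density_pmf B) (A \<inter> X)"
    using set_density[OF assms]
    by (intro measure_pmf.finite_measure_eq_AE) (auto simp: AE_measure_pmf_iff)
  also have "\<dots> = (\<Sum>x\<in>A \<inter> X. W B x / real q ^ n)"
    by (simp add: measure_measure_pmf_finite pmf_density[OF assms])
  also have "\<dots> = (\<Sum>x\<in>X. of_bool (x \<in> A) * W B x / real q ^ n)"
    by (rule sum.mono_neutral_cong_left) auto
  finally show ?thesis by (simp only: sum_divide_distrib)
qed

text \<open>The indicator of \<open>A\<close> is a function of the variables common to
  \<open>S\<close> and \<open>S'\<close>, so \<open>sum_good_agree\<close> applies to it.\<close>

lemma prob_density_agree:
  assumes "good S B" "good S' B'" "\<And>x x'. (\<forall>i\<in>S \<inter> S'. x i = x' i) \<Longrightarrow> x \<in> A \<longleftrightarrow> x' \<in> A"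
  shows "measure_pmf.prob (density_pmf B) A = measure_pmf.prob (density_pmf B') A"
proof -
  have "B \<subseteq> {..<m}" "card B \<le> L" "B' \<subseteq> {..<m}" "card B' \<le> L"
    using assms by (auto simp: good_def)
  moreover have "depends_on (S \<inter> S') (\<lambda>x. of_bool (x \<in> A))"
    unfolding depends_on_def
  proof (intro ballI impI)
    fix x x' :: "nat \<Rightarrow> nat" assume "\<forall>i\<in>S \<inter> S'. x i = x' i"
    then have "x \<in> A \<longleftrightarrow> x' \<in> A" by (rule assms(3))
    then show "(of_bool (x \<in> A) :: real) = of_bool (x' \<in> A)" by simp
  qed
  then have "depends_on S (\<lambda>x. of_bool (x \<in> A))" "depends_on S' (\<lambda>x. of_bool (x \<in> A))"
    by (auto intro: depends_on_mono)
  ultimately show ?thesis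
    using sum_good_agree[OF assms(1,2), of "\<lambda>x. of_bool (x \<in> A)"] by (simp add: prob_density)
qed

text \<open>\<open>K\<close> consists of \<open>i\<close> and the variables of a largest constraint set \<open>B\<close> that is as dense as a core
  relative to \<open>{i}\<close>. A core \<open>F\<close> relative to \<open>K \<union> {j}\<close> that met \<open>K\<close> could be added to \<open>B\<close>: the slot in
  \<open>K\<close> makes up for \<open>j\<close> being counted as a new variable.\<close>

lemma uncorrelated_closure:
  assumes i: "i < n" and L: "(1 / \<delta>) + (k / \<delta> + 2) / \<delta> \<le> L"
  obtains K where "i \<in> K" "K \<subseteq> {..<n}" "card K \<le> k / \<delta> + 1"
    "\<And>j. j < n \<Longrightarrow> j \<notin> K \<Longrightarrow>
       \<exists>B g h. good (insert j K) B \<and> depends_on K g \<and> depends_on ({..<n} - K) h \<and>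
         (\<forall>x. W B x = g x * h x)"
proof -
  \<comment> \<open>Members satisfy the slot count of a core relative to \<open>{i}\<close> without
    having to be cores. This inequality survives the addition of \<open>F\<close> below, although
    \<open>F\<close> is a core only relative to a set containing \<open>j\<close>.\<close>
  define \<F> where
    "\<F> = {B. B \<subseteq> {..<m} \<and> card B \<le> 2 * L \<and> 2 * card (nbr B - {i}) + t * card B \<le> 2 * (k * card B)}"
  have "finite \<F>" unfolding \<F>_def by (rule finite_subset[of _ "Pow {..<m}"]) auto
  moreover have "{} \<in> \<F>" by (simp add: \<F>_def nbr_def)
  ultimately obtain B where B: "B \<in> \<F>" and max: "\<And>B'. B' \<in> \<F> \<Longrightarrow> card B' \<le> card B"
    by (rule finite_max_card) blast
  have Bm: "B \<subseteq> {..<m}" using B by (simp add: \<F>_def)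
  have finB: "finite B" using Bm finite_subset by blast
  have "\<delta> * card B \<le> card {i}"
    using B by (intro dense_card_bound) (auto simp: \<F>_def)
  then have cB: "card B \<le> 1 / \<delta>" using delta_pos by (simp add: field_simps)
  define K where "K = insert i (nbr B)"
  have finK: "finite K" using finite_nbr[OF finB] by (simp add: K_def)
  have "real (card K) \<le> real (k * card B) + 1"
    using card_nbr_le[OF finB] card_insert_le_m1[of "card (nbr B) + 1" "nbr B" i]
    by (simp add: K_def del: of_nat_mult)
  moreover have "real (k * card B) \<le> k / \<delta>"
    using mult_left_mono[OF cB, of "real k"] by simp
  ultimately have cK: "card K \<le> k / \<delta> + 1" by linarith
  have "\<exists>B g h. good (insert j K) B \<and> depends_on K g \<and> depends_on ({..<n} - K) h \<and>
         (\<forall>x. W B x = g x * h x)" if j: "j < n" "j \<notin> K" for j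
  proof -
    have U: "insert j K \<union> nbr B = insert j K" by (auto simp: K_def)
    have "real (card (insert j K)) \<le> k / \<delta> + 2"
      using cK j finK by simp
    then have "real (card B) + card (insert j K) / \<delta> \<le> (1 / \<delta>) + (k / \<delta> + 2) / \<delta>"
      using cB delta_pos by (intro add_mono divide_right_mono) auto
    then have "real (card B) + card (insert j K \<union> nbr B) / \<delta> \<le> L"
      using L unfolding U by linarith
    from ex_good[OF Bm _ this] finK obtain F where F: "F \<subseteq> {..<m} - B" "card F \<le> L"
      "core (insert j K) F" "good (insert j K) (B \<union> F)"
      unfolding U by auto
    have finF: "finite F" using F(1) finite_subset[of F "{..<m}"] by auto
    have disj: "B \<inter> F = {}" using F by auto
    have noK: "nbr F \<inter> K = {}"
    proof (rule ccontr)
      assume "nbr F \<inter> K \<noteq> {}"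
      then obtain l1 j1 where 1: "l1 \<in> F" "j1 < k" "v l1 j1 \<in> K" by (auto simp: nbr_def)
      define A where "A = {(l, j') \<in> F \<times> {..<k}. v l j' \<in> insert j K}"
      have finA: "finite A"
        unfolding A_def using finF by (auto intro: finite_subset[of _ "F \<times> {..<k}"])
      have count: "2 * card (nbr F - insert j K) + t * card F + card A \<le> 2 * (k * card F)"
        unfolding A_def using core_slot_count[OF finF F(3)] .
      have "2 * card (nbr F - K) + t * card F \<le> 2 * (k * card F)"
      proof (cases "j \<in> nbr F")
        case True
        then obtain l2 j2 where 2: "l2 \<in> F" "j2 < k" "v l2 j2 = j" by (auto simp: nbr_def)
        \<comment> \<open>One slot lies over \<open>K\<close> and another over \<open>j\<close>,
          which is not in \<open>K\<close>. These two slots balance the 2 by which \<open>j\<close>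
          as a new variable raises the left-hand side.\<close>
        have "{(l1, j1), (l2, j2)} \<subseteq> A" using 1 2 by (auto simp: A_def)
        then have "card {(l1, j1), (l2, j2)} \<le> card A" using finA card_mono by blast
        moreover have "card {(l1, j1), (l2, j2)} = 2"
          using 1 2 j by (metis card_2_iff prod.inject)
        ultimately have A2: "2 \<le> card A" by simp
        have "nbr F - K = insert j (nbr F - insert j K)" using True j by auto
        moreover have "card (insert j (nbr F - insert j K)) = Suc (card (nbr F - insert j K))"
          using finite_nbr[OF finF] by simp
        ultimately have "card (nbr F - K) = Suc (card (nbr F - insert j K))"
          by (simp only:)
        then show ?thesis using count A2 by linarith
      next
        case False
        then have "card (nbr F - K) = card (nbr F - insert j K)"
          by (intro arg_cong[where f = card]) auto
        then show ?thesis using count by linarith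
      qed
      moreover have "card (nbr (B \<union> F) - {i}) \<le> card (nbr B - {i}) + card (nbr F - K)"
      proof -
        have "nbr (B \<union> F) - {i} \<subseteq> (nbr B - {i}) \<union> (nbr F - K)"
          by (auto simp: nbr_Un K_def)
        then have "card (nbr (B \<union> F) - {i}) \<le> card ((nbr B - {i}) \<union> (nbr F - K))"
          using finite_nbr finB finF by (intro card_mono) auto
        then show ?thesis using card_Un_le le_trans by blast
      qed
      moreover have card: "card (B \<union> F) = card B + card F"
        using card_Un_disjoint[OF finB finF disj] .
      moreover have "card (B \<union> F) \<le> L" using F(4) by (simp add: good_def)
      ultimately have "B \<union> F \<in> \<F>"
        using B F(1) by (auto simp: \<F>_def algebra_simps)
      then have "card B + card F \<le> card B" using max card by metis
      then show False using finF 1 by auto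
    qed
    \<comment> \<open>The factors are \<open>W B\<close> and \<open>W F\<close>: the variables of
      \<open>B\<close> lie in \<open>K\<close>, those of \<open>F\<close> outside.\<close>
    have "depends_on K (W B)" by (rule depends_on_mono[OF depends_on_W]) (auto simp: K_def)
    moreover have "depends_on ({..<n} - K) (W F)"
      using noK nbr_subset[of F] F(1) by (intro depends_on_mono[OF depends_on_W]) auto
    moreover have "\<forall>x. W (B \<union> F) x = W B x * W F x"
      using W_Un[OF finB finF disj] by blast
    ultimately show ?thesis using F(4) by blast
  qed
  moreover have "K \<subseteq> {..<n}" using i nbr_subset[OF Bm] by (auto simp: K_def)
  ultimately show ?thesis using cK by (intro that[of K]) (auto simp: K_def)
qed

end

subsection \<open>The family of local distributions and its moments\<close>

text \<open>The first bound provides a good set for each \<open>S\<close> of at most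
  \<open>r\<close> variables, the second gives the blocks of \<open>uncorrelated_closure\<close> a
  local distribution, the third covers pair moments, and the fourth is the hypothesis of
  \<open>uncorrelated_closure\<close>. By \<open>L_pos\<close> a single constraint may be added to a
  good set.\<close>

locale relaxed_instance = expanding_instance +
  fixes r :: nat
  assumes radius: "r / \<delta> \<le> L" "k / \<delta> + 1 \<le> r" "2 \<le> r" "(1 / \<delta>) + (k / \<delta> + 2) / \<delta> \<le> L"
    and L_pos: "0 < L"
begin

text \<open>Any good set gives the same marginal on \<open>S\<close>, by
  \<open>prob_density_agree\<close>.\<close>

definition closure_set :: "nat set \<Rightarrow> nat set" where
  "closure_set S = (SOME B. good S B)"

definition D :: dist_family where
  "D = (\<lambda>S\<in>{S. S \<subseteq> {..<n} \<and> card S \<le> r}.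
          map_pmf (\<lambda>x. restrict x S) (density_pmf (closure_set S)))"

text \<open>Apply \<open>ex_good\<close> starting from no constraints; then only \<open>S\<close>
  has to be paid for, and \<open>r / \<delta> \<le> L\<close> suffices.\<close>

lemma good_closure_set:
  assumes "S \<subseteq> {..<n}" "card S \<le> r"
  shows "good S (closure_set S)"
proof -
  have "card S / \<delta> \<le> r / \<delta>"
    using assms(2) delta_pos by (simp add: divide_right_mono)
  then have small: "real (card ({} :: nat set)) + card (S \<union> nbr {}) / \<delta> \<le> L"
    using radius(1) by (simp add: nbr_def)
  have "finite S" using assms(1) finite_subset by blast
  from ex_good[OF _ this small] have "\<exists>B. good S B" by auto
  then show ?thesis unfolding closure_set_def by (rule someI_ex)
qed

text \<open>A good set for a larger \<open>S'\<close> computes the same local distribution as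
  \<open>closure_set S\<close>. Thus local distributions on several subsets of \<open>S'\<close> can
  be evaluated under one common measure.\<close>

lemma prob_D:
  assumes "S \<subseteq> {..<n}" "card S \<le> r" "good S' B" "S \<subseteq> S'"
  shows "measure_pmf.prob (D S) A = measure_pmf.prob (density_pmf B) {x. restrict x S \<in> A}"
proof -
  have "measure_pmf.prob (D S) A
      = measure_pmf.prob (density_pmf (closure_set S)) {x. restrict x S \<in> A}"
    using assms by (simp add: D_def measure_map_pmf vimage_def)
  also have "\<dots> = measure_pmf.prob (density_pmf B) {x. restrict x S \<in> A}"
  proof (rule prob_density_agree[OF good_closure_set[OF assms(1,2)] assms(3)])
    fix x x' :: "nat \<Rightarrow> nat" assume "\<forall>i\<in>S \<inter> S'. x i = x' i"
    then have "restrict x S = restrict x' S" using assms(4) by (auto simp: restrict_def fun_eq_iff)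
    then show "x \<in> {x. restrict x S \<in> A} \<longleftrightarrow> x' \<in> {x. restrict x S \<in> A}" by simp
  qed
  finally show ?thesis .
qed

lemma set_D:
  assumes "S \<subseteq> {..<n}" "card S \<le> r"
  shows "set_pmf (D S) \<subseteq> S \<rightarrow>\<^sub>E {..<q}"
proof -
  have "set_pmf (density_pmf (closure_set S)) \<subseteq> X"
    using good_closure_set[OF assms] by (intro set_density) (auto simp: good_def)
  then show ?thesis
    using assms by (fastforce simp: D_def X_def PiE_iff)
qed

lemma locally_consistent_D: "locally_consistent q n r D"
  unfolding locally_consistent_def
proof (intro conjI allI impI)
  show "D \<in> (\<Pi>\<^sub>E S\<in>{S. S \<subseteq> {..<n} \<and> card S \<le> r}. {\<nu>. set_pmf \<nu> \<subseteq> S \<rightarrow>\<^sub>E {..<q}})"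
  proof (rule PiE_I)
    show "D S \<in> {\<nu>. set_pmf \<nu> \<subseteq> S \<rightarrow>\<^sub>E {..<q}}" if "S \<in> {S. S \<subseteq> {..<n} \<and> card S \<le> r}" for S
      using that set_D by simp
  qed (auto simp: D_def)
  fix S T assume ST: "T \<subseteq> S \<and> S \<subseteq> {..<n} \<and> card S \<le> r"
  have finS: "finite S" using ST finite_subset by blast
  have T: "T \<subseteq> {..<n}" "card T \<le> r" using ST card_mono[OF finS, of T] by auto
  show "map_pmf (\<lambda>y. restrict y T) (D S) = D T"
  proof (rule pmf_eqI)
    fix y
    have *: "restrict (restrict x S) T = restrict x T" for x :: "nat \<Rightarrow> nat"
      using ST by (simp add: Int_absorb1)
    have "pmf (map_pmf (\<lambda>y. restrict y T) (D S)) y = measure_pmf.prob (D S) {z. restrict z T = y}"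
      by (simp add: pmf_map vimage_def)
    \<comment> \<open>Both \<open>D S\<close> and \<open>D T\<close> are evaluated with the closure
      of the larger set \<open>S\<close>.\<close>
    also have "\<dots> = measure_pmf.prob (density_pmf (closure_set S)) {x. restrict x T = y}"
      using ST by (subst prob_D[OF _ _ good_closure_set[of S]]) (auto simp: * simp del: restrict_restrict)
    also have "\<dots> = measure_pmf.prob (D T) {y}"
      using ST T by (subst prob_D[OF T good_closure_set[of S]]) auto
    finally show "pmf (map_pmf (\<lambda>y. restrict y T) (D S)) y = pmf (D T) y"
      by (simp add: measure_pmf_single)
  qed
qed

text \<open>Constraint \<open>l\<close> may be added to the closure of \<open>V\<close> without
  changing the probability of events on \<open>V\<close>. Once it is added, every assignment whose
  view lies outside the support of \<mu> has weight 0.\<close>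

lemma D_satisfies:
  assumes l: "l < m" and V: "V \<subseteq> {..<n}" "card V \<le> r" "v l ` {..<k} \<subseteq> V"
    and y: "y \<in> set_pmf (D V)"
  shows "view l y \<in> set_pmf \<mu>"
proof -
  define B where "B = closure_set V"
  have B: "good V B" using good_closure_set V by (simp add: B_def)
  then have Bm: "B \<subseteq> {..<m}" "card B \<le> L" by (auto simp: good_def)
  define g :: "(nat \<Rightarrow> nat) \<Rightarrow> real" where "g x = of_bool (view l x \<notin> set_pmf \<mu>)" for x
  have view_cong: "view l x = view l x'" if "\<forall>i\<in>V. x i = x' i" for x x'
    using that V(3) by (auto simp: view_def fun_eq_iff)
  have view_restrict: "view l (restrict x V) = view l x" for x
    by (rule view_cong) simp
  have "depends_on V g"
    unfolding depends_on_def g_def using view_cong by metis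
  have "measure_pmf.prob (D V) {y. view l y \<notin> set_pmf \<mu>} = (\<Sum>x\<in>X. g x * W B x) / real q ^ n"
    by (subst prob_D[OF V(1,2) B]) (auto simp: prob_density[OF Bm] view_restrict g_def)
  also have "(\<Sum>x\<in>X. g x * W B x) = (\<Sum>x\<in>X. g x * W (B \<union> {l}) x)"
    using sum_good_extend[OF B _ _ \<open>depends_on V g\<close>, of "{l}"] l L_pos by simp
  also have "\<dots> = 0"
  proof (rule sum.neutral, rule ballI)
    fix x
    have "finite (B \<union> {l})" using Bm finite_subset by auto
    then have "W (B \<union> {l}) x = 0" if "view l x \<notin> set_pmf \<mu>"
      unfolding W_def using that by (intro prod_zero) (auto simp: set_pmf_iff)
    then show "g x * W (B \<union> {l}) x = 0" by (auto simp: g_def)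
  qed
  finally have "measure_pmf.prob (D V) {y. view l y \<notin> set_pmf \<mu>} = 0" by simp
  then have "AE y in measure_pmf (D V). \<not> y \<in> {y. view l y \<notin> set_pmf \<mu>}"
    by (subst (asm) measure_pmf.prob_eq_0) auto
  then show ?thesis using y by (auto simp: AE_measure_pmf_iff)
qed

text \<open>All three probabilities are computed with the same \<open>B\<close>, whose weight is a
  function on \<open>K\<close> times a function on the complement; hence \<open>i\<close> and
  \<open>j\<close> are independent.\<close>

lemma moment_factor:
  assumes ij: "i \<in> K" "K \<subseteq> {..<n}" "j < n" "j \<notin> K"
    and B: "good (insert j K) B" and g: "depends_on K g" and h: "depends_on ({..<n} - K) h"
    and W: "\<And>x. W B x = g x * h x"
  shows "measure_pmf.prob (D {i, j}) {y. y i = a \<and> y j = b}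
    = measure_pmf.prob (D {i}) {y. y i = a} * measure_pmf.prob (D {j}) {y. y j = b}"
proof -
  have Bm: "B \<subseteq> {..<m}" "card B \<le> L" using B by (auto simp: good_def)
  have i: "i < n" "i \<noteq> j" using ij by auto
  define u :: "(nat \<Rightarrow> nat) \<Rightarrow> real" where "u x = of_bool (x i = a) * g x" for x
  define w :: "(nat \<Rightarrow> nat) \<Rightarrow> real" where "w x = of_bool (x j = b) * h x" for x
  have u: "depends_on K u"
    unfolding u_def using ij by (intro depends_on_mult g) (auto simp: depends_on_def)
  have w: "depends_on ({..<n} - K) w"
    unfolding w_def using ij by (intro depends_on_mult h) (auto simp: depends_on_def)
  have disj: "K \<inter> ({..<n} - K) = {}" by auto
  note ind = sum_mult_independent[OF _ _ disj]
  have card2: "card {i, j} \<le> r" "card {i} \<le> r" "card {j} \<le> r" using radius(3) i by auto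
  have pij: "measure_pmf.prob (D {i, j}) {y. y i = a \<and> y j = b} = (\<Sum>x\<in>X. u x * w x) / real q ^ n"
    using ij i card2
    by (subst prob_D[OF _ _ B]) (auto simp: prob_density[OF Bm] u_def w_def W of_bool_conj
          intro!: arg_cong2[where f = "(/)"] sum.cong)
  have pi: "measure_pmf.prob (D {i}) {y. y i = a} = (\<Sum>x\<in>X. u x * h x) / real q ^ n"
    using ij i card2
    by (subst prob_D[OF _ _ B]) (auto simp: prob_density[OF Bm] u_def W mult.assoc)
  have pj: "measure_pmf.prob (D {j}) {y. y j = b} = (\<Sum>x\<in>X. g x * w x) / real q ^ n"
    using ij i card2
    by (subst prob_D[OF _ _ B]) (auto simp: prob_density[OF Bm] w_def W mult.left_commute)
  have one: "(\<Sum>x\<in>X. g x * h x) = real q ^ n" using sum_W[OF Bm] by (simp add: W)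
  define Q where "Q = real q ^ n"
  have Q: "Q \<noteq> 0" using q_pos by (simp add: Q_def)
  \<comment> \<open>As \<open>sum g X * sum h X\<close> equals \<open>Q * Q\<close>, the four sums
    can be regrouped: pairing \<open>u\<close> with \<open>h\<close> and \<open>g\<close> with
    \<open>w\<close> yields the two single moments.\<close>
  have "Q * (\<Sum>x\<in>X. u x * w x) * (Q * Q)
      = (sum u X * sum w X) * (sum g X * sum h X)"
    using ind[OF u w] ind[OF g h] one by (simp add: Q_def)
  also have "\<dots> = (sum u X * sum h X) * (sum g X * sum w X)" by (simp add: mult_ac)
  also have "\<dots> = (Q * (\<Sum>x\<in>X. u x * h x)) * (Q * (\<Sum>x\<in>X. g x * w x))"
    using ind[OF u h] ind[OF g w] by (simp add: Q_def)
  finally show ?thesis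
    unfolding pij pi pj Q_def[symmetric] using Q by (simp add: field_simps)
qed

lemma psd_moment_matrix: "psd_matrix_on (insert None (Some ` ({..<n} \<times> {..<q}))) (moment_matrix D)"
  unfolding psd_matrix_on_def
proof (intro conjI ballI allI)
  define p where "p i a = measure_pmf.prob (D {i}) {y. y i = a}" for i a
  define pp where "pp i a j b = measure_pmf.prob (D {i, j}) {y. y i = a \<and> y j = b}" for i a j b
  have pp_sym: "pp i a j b = pp j b i a" for i a j b
    by (auto simp: pp_def insert_commute intro!: arg_cong2[where f = measure_pmf.prob])
  show "moment_matrix D u v = moment_matrix D v u" for u v
  proof (cases "u = None \<or> v = None")
    case True
    then show ?thesis by (cases u; cases v) auto
  next
    case False
    then obtain i a j b where "u = Some (i, a)" "v = Some (j, b)" by auto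
    then show ?thesis using pp_sym[of i a j b] by (simp add: pp_def)
  qed
  fix f :: "(nat \<times> nat) option \<Rightarrow> real"
  \<comment> \<open>\<open>T i j\<close> will be the covariance of \<open>h i\<close> and
    \<open>h j\<close>, where \<open>h i\<close> reads off the coefficient selected by the value of
    variable \<open>i\<close>.\<close>
  define T where "T i j = (\<Sum>a<q. \<Sum>b<q. f (Some (i, a)) * f (Some (j, b)) * (pp i a j b - p i a * p j b))"
    for i j
  define h where "h i y = (\<Sum>a<q. f (Some (i, a)) * of_bool (y i = a))" for i and y :: "nat \<Rightarrow> nat"
  have "\<forall>i\<in>{..<n}. \<exists>K. i \<in> K \<and> K \<subseteq> {..<n} \<and> card K \<le> r \<and> (\<forall>i' j a b. i' \<in> K \<longrightarrow> j < n \<longrightarrow> j \<notin> K \<longrightarrow>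
      pp i' a j b = p i' a * p j b)"
  proof
    fix i assume "i \<in> {..<n}"
    then have "i < n" by simp
    obtain K where K: "i \<in> K" "K \<subseteq> {..<n}" "card K \<le> k / \<delta> + 1"
      and sep: "\<And>j. j < n \<Longrightarrow> j \<notin> K \<Longrightarrow>
       \<exists>B g h. good (insert j K) B \<and> depends_on K g \<and> depends_on ({..<n} - K) h \<and>
         (\<forall>x. W B x = g x * h x)"
      using uncorrelated_closure[OF \<open>i < n\<close> radius(4)] by blast
    have "pp i' a j b = p i' a * p j b" if "i' \<in> K" "j < n" "j \<notin> K" for i' j a b
      using sep[OF that(2,3)] moment_factor[OF that(1) K(2) that(2,3)] unfolding p_def pp_def by blast
    moreover have "card K \<le> r" using K(3) radius(2) by linarith
    ultimately show "\<exists>K. i \<in> K \<and> K \<subseteq> {..<n} \<and> card K \<le> r \<and>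
      (\<forall>i' j a b. i' \<in> K \<longrightarrow> j < n \<longrightarrow> j \<notin> K \<longrightarrow> pp i' a j b = p i' a * p j b)"
      using K by blast
  qed
  then obtain K where "\<forall>i\<in>{..<n}. i \<in> K i \<and> K i \<subseteq> {..<n} \<and> card (K i) \<le> r \<and>
      (\<forall>i' j a b. i' \<in> K i \<longrightarrow> j < n \<longrightarrow> j \<notin> K i \<longrightarrow> pp i' a j b = p i' a * p j b)"
    unfolding bchoice_iff by (rule exE)
  then have K: "\<And>i. i < n \<Longrightarrow> i \<in> K i" "\<And>i. i < n \<Longrightarrow> K i \<subseteq> {..<n}"
      "\<And>i. i < n \<Longrightarrow> card (K i) \<le> r"
    and sep: "\<And>i i' j a b. i < n \<Longrightarrow> i' \<in> K i \<Longrightarrow> j < n \<Longrightarrow> j \<notin> K i \<Longrightarrow> pp i' a j b = p i' a * p j b"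
    by simp_all
  have nonneg: "0 \<le> (\<Sum>i<n. \<Sum>j<n. T i j)"
  proof (rule quadratic_form_nonneg_by_blocks[where K = K])
    show "T i' j = 0 \<and> T j i' = 0"
      if "i \<in> {..<n}" "i' \<in> {..<n}" "j \<in> {..<n}" "i' \<in> K i" "j \<notin> K i" for i i' j
    proof -
      have "pp i' a j b = p i' a * p j b" for a b using sep that by simp
      moreover from this have "pp j b i' a = p j b * p i' a" for a b
        using pp_sym[of j b i' a] by simp
      ultimately show ?thesis by (simp add: T_def)
    qed
    show "0 \<le> (\<Sum>a\<in>C. \<Sum>b\<in>C. T a b)" if i: "i \<in> {..<n}" and C: "C \<subseteq> K i \<inter> {..<n}" for i C
    proof -
      have Ki: "K i \<subseteq> {..<n}" "card (K i) \<le> r" using K i by auto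
      let ?E = "measure_pmf.expectation (D (K i))"
      have "finite (K i \<rightarrow>\<^sub>E {..<q})" using Ki finite_subset by (intro finite_PiE) auto
      then have fin: "finite (set_pmf (D (K i)))" using set_D[OF Ki] finite_subset by blast
      have int: "integrable (measure_pmf (D (K i))) F" for F :: "_ \<Rightarrow> real"
        using fin by (rule integrable_measure_pmf_finite)
      have E_of_bool: "?E (\<lambda>y. of_bool (R y)) = measure_pmf.prob (D (K i)) {y. R y}" for R
      proof -
        have "(\<lambda>y. of_bool (R y) :: real) = indicator {y. R y}" by (auto simp: indicator_def)
        then show ?thesis by simp
      qed
      \<comment> \<open>Single and pair moments inside \<open>K i\<close> are moments of the one
        distribution \<open>D (K i)\<close>, which makes the block a true covariance form.\<close>
      have marg: "measure_pmf.prob (D S) {y. R y} = measure_pmf.prob (D (K i)) {y. R y}"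
        if S: "S \<subseteq> K i" and R: "\<And>y. R (restrict y S) = R y" for S R
      proof -
        have "card S \<le> r" using S Ki card_mono[of "K i" S] finite_subset[OF Ki(1)] by auto
        moreover have "R (restrict y (K i)) = R y" for y
          using R[of "restrict y (K i)"] R[of y] S by (simp add: Int_absorb1)
        ultimately show ?thesis
          using S Ki R prob_D[OF _ _ good_closure_set[OF Ki], of S]
            prob_D[OF Ki good_closure_set[OF Ki]] by simp
      qed
      have "T a b = ?E (\<lambda>y. h a y * h b y) - ?E (h a) * ?E (h b)" if "a \<in> C" "b \<in> C" for a b
      proof -
        have 1: "p a' c = ?E (\<lambda>y. of_bool (y a' = c))" if "a' \<in> C" for a' c
          unfolding p_def E_of_bool using that C by (intro marg) auto
        have 2: "pp a c b d = ?E (\<lambda>y. of_bool (y a = c) * of_bool (y b = d))" for c d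
          unfolding pp_def of_bool_conj[symmetric] E_of_bool using \<open>a \<in> C\<close> \<open>b \<in> C\<close> C
          by (intro marg) auto
        have Eh: "?E (h a') = (\<Sum>c<q. f (Some (a', c)) * p a' c)" if "a' \<in> C" for a'
          unfolding h_def 1[OF that]
          by (subst Bochner_Integration.integral_sum) (simp_all add: int)
        have "?E (\<lambda>y. h a y * h b y)
            = ?E (\<lambda>y. \<Sum>c<q. \<Sum>d<q. f (Some (a, c)) * f (Some (b, d)) * (of_bool (y a = c) * of_bool (y b = d)))"
          unfolding h_def sum_product by (simp add: mult_ac)
        also have "\<dots> = (\<Sum>c<q. \<Sum>d<q. f (Some (a, c)) * f (Some (b, d)) * pp a c b d)"
          unfolding 2 by (simp add: Bochner_Integration.integral_sum int)
        finally show ?thesis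
          unfolding Eh[OF \<open>a \<in> C\<close>] Eh[OF \<open>b \<in> C\<close>] T_def sum_product
          by (simp add: right_diff_distrib sum_subtractf mult_ac)
      qed
      then have "(\<Sum>a\<in>C. \<Sum>b\<in>C. T a b)
          = (\<Sum>a\<in>C. \<Sum>b\<in>C. ?E (\<lambda>y. h a y * h b y) - ?E (h a) * ?E (h b))"
        by simp
      then show ?thesis using covariance_form_nonneg[OF fin, of h C] by simp
    qed
  qed (use K in auto)
  define J where "J = insert None (Some ` ({..<n} \<times> {..<q}))"
  have sumJ: "(\<Sum>u\<in>J. G u) = G None + (\<Sum>i<n. \<Sum>a<q. G (Some (i, a)))"
    for G :: "_ \<Rightarrow> real"
    unfolding J_def by (subst sum.insert)
      (auto simp: sum.reindex sum.cartesian_product intro!: sum.cong)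
  define s where "s = (\<Sum>i<n. \<Sum>a<q. f (Some (i, a)) * p i a)"
  have "(\<Sum>u\<in>J. \<Sum>v\<in>J. f u * moment_matrix D u v * f v)
     = f None * f None + 2 * (f None * s)
       + (\<Sum>i<n. \<Sum>a<q. \<Sum>j<n. \<Sum>b<q. f (Some (i, a)) * pp i a j b * f (Some (j, b)))"
    unfolding sumJ s_def
    by (simp add: sum.distrib sum_distrib_left p_def pp_def mult_ac)
  also have "(\<Sum>i<n. \<Sum>a<q. \<Sum>j<n. \<Sum>b<q. f (Some (i, a)) * pp i a j b * f (Some (j, b)))
     = (\<Sum>i<n. \<Sum>j<n. T i j) + s * s"
  proof -
    have "s * s = (\<Sum>i<n. \<Sum>j<n. \<Sum>a<q. \<Sum>b<q. f (Some (i, a)) * f (Some (j, b)) * (p i a * p j b))"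
      unfolding s_def sum_product by (simp add: mult_ac)
    then have "(\<Sum>i<n. \<Sum>j<n. T i j) + s * s
        = (\<Sum>i<n. \<Sum>j<n. \<Sum>a<q. \<Sum>b<q. f (Some (i, a)) * f (Some (j, b)) * pp i a j b)"
      unfolding T_def by (simp add: sum.distrib[symmetric] right_diff_distrib)
    also have "\<dots> = (\<Sum>i<n. \<Sum>a<q. \<Sum>j<n. \<Sum>b<q. f (Some (i, a)) * f (Some (j, b)) * pp i a j b)"
      by (intro sum.cong refl sum.swap)
    finally show ?thesis by (simp add: mult_ac)
  qed
  \<comment> \<open>Completing the square in \<open>f None\<close> eliminates the index
    \<open>None\<close>.\<close>
  also have "f None * f None + 2 * (f None * s) + ((\<Sum>i<n. \<Sum>j<n. T i j) + s * s)
      = (f None + s)\<^sup>2 + (\<Sum>i<n. \<Sum>j<n. T i j)"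
    by (simp add: power2_eq_square algebra_simps)
  finally show "0 \<le> (\<Sum>u\<in>insert None (Some ` ({..<n} \<times> {..<q})).
      \<Sum>v\<in>insert None (Some ` ({..<n} \<times> {..<q})). f u * moment_matrix D u v * f v)"
    using nonneg by (simp add: J_def)
qed

end

subsection \<open>Constraint polynomials\<close>

definition sqfree_mon :: "(nat \<times> nat) set \<Rightarrow> monomial" where
  "sqfree_mon S = (\<Sum>v\<in>S. Poly_Mapping.single v 1)"

lemma lookup_sqfree_mon: "finite S \<Longrightarrow> Poly_Mapping.lookup (sqfree_mon S) v = (if v \<in> S then 1 else 0)"
  by (simp add: sqfree_mon_def lookup_sum lookup_single when_def)

lemma keys_sqfree_mon: "finite S \<Longrightarrow> Poly_Mapping.keys (sqfree_mon S) = S"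
  by (auto simp: in_keys_iff lookup_sqfree_mon split: if_splits)

lemma keys_add_nat:
  "Poly_Mapping.keys (a + b :: 'a \<Rightarrow>\<^sub>0 nat) = Poly_Mapping.keys a \<union> Poly_Mapping.keys b"
  by (auto simp: in_keys_iff lookup_add)

lemma keys_sum_single_nat:
  "finite A \<Longrightarrow> Poly_Mapping.keys (\<Sum>i\<in>A. Poly_Mapping.single (f i) (1 :: nat)) = f ` A"
  by (induction A rule: finite_induct) (auto simp: keys_add_nat)

lemma multilinear_form_single:
  "multilinear_form (Poly_Mapping.single w a) = Poly_Mapping.single (sqfree_mon (Poly_Mapping.keys w)) a"
  by (cases "a = 0") (simp_all add: multilinear_form_def sqfree_mon_def)

lemma multilinear_form_add: "multilinear_form (p + q) = multilinear_form p + multilinear_form q"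
  unfolding multilinear_form_def
  by (rule setsum_keys_plus_distrib) (simp_all add: single_add)

lemma multilinear_form_sum: "multilinear_form (\<Sum>i\<in>A. p i) = (\<Sum>i\<in>A. multilinear_form (p i))"
proof (induction A rule: infinite_finite_induct)
  case (insert x A)
  then show ?case by (simp add: multilinear_form_add)
qed (simp_all add: multilinear_form_def)

lemma eval_poly_single:
  "eval_poly (Poly_Mapping.single w a) z
     = a * (\<Prod>v\<in>Poly_Mapping.keys w. z v ^ Poly_Mapping.lookup w v)"
  by (cases "a = 0") (simp_all add: eval_poly_def)

lemma eval_poly_add: "eval_poly (p + q) z = eval_poly p z + eval_poly q z"
  unfolding eval_poly_def
  by (rule setsum_keys_plus_distrib) (simp_all add: algebra_simps)

lemma eval_poly_sum: "eval_poly (\<Sum>i\<in>A. p i) z = (\<Sum>i\<in>A. eval_poly (p i) z)"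
proof (induction A rule: infinite_finite_induct)
  case (insert x A)
  then show ?case by (simp add: eval_poly_add)
qed (simp_all add: eval_poly_def)

lemma eval_poly_sqfree_mon:
  assumes "finite S"
  shows "eval_poly (Poly_Mapping.single (sqfree_mon S) a) (encode y)
     = a * of_bool (\<forall>(i, b)\<in>S. y i = b)"
proof -
  have "(\<Prod>v\<in>S. encode y v) = of_bool (\<forall>(i, b)\<in>S. y i = b)"
    using assms by (induction S rule: finite_induct) (auto simp: encode_def)
  then show ?thesis
    using assms by (simp add: eval_poly_single keys_sqfree_mon lookup_sqfree_mon)
qed

lemma prod_single_1:
  "finite A \<Longrightarrow> (\<Prod>i\<in>A. Poly_Mapping.single (f i) (1 :: real)) = Poly_Mapping.single (\<Sum>i\<in>A. f i) 1"
  by (induction A rule: finite_induct) (simp_all add: mult_single)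

text \<open>Reduction remembers only the set of variables of a monomial, so variables repeated in
  the constraint or already present in the indicator merge in \<open>s \<beta>\<close>. The last
  summand comes from subtracting 1.\<close>

lemma multilinear_form_constraint:
  fixes q k :: nat and \<alpha> :: "nat \<Rightarrow> nat" and C :: csp_constraint and P :: "(nat \<Rightarrow> nat) \<Rightarrow> real"
  assumes T: "finite T"
  defines "s \<equiv> \<lambda>\<beta>. (\<lambda>i. (i, \<alpha> i)) ` T \<union> (\<lambda>j. (snd C j, (\<beta> j + fst C j) mod q)) ` {..<k}"
  shows "multilinear_form (assignment_indicator T \<alpha> * (P01 q k P (shifted_vars q C) - 1))
     = (\<Sum>\<beta>\<in>{..<k} \<rightarrow>\<^sub>E {..<q}. Poly_Mapping.single (sqfree_mon (s \<beta>)) (P \<beta>))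
       + Poly_Mapping.single (sqfree_mon ((\<lambda>i. (i, \<alpha> i)) ` T)) (- 1)"
proof -
  define wT :: monomial where "wT = (\<Sum>i\<in>T. Poly_Mapping.single (i, \<alpha> i) 1)"
  define w :: "(nat \<Rightarrow> nat) \<Rightarrow> monomial"
    where "w \<beta> = (\<Sum>j<k. Poly_Mapping.single (snd C j, (\<beta> j + fst C j) mod q) 1)" for \<beta>
  have "assignment_indicator T \<alpha> = Poly_Mapping.single wT 1"
    using T by (simp add: assignment_indicator_def var_poly_def prod_single_1 wT_def)
  moreover have "P01 q k P (shifted_vars q C)
      = (\<Sum>\<beta>\<in>{..<k} \<rightarrow>\<^sub>E {..<q}. Poly_Mapping.single (w \<beta>) (P \<beta>))"
    by (simp add: P01_def shifted_vars_def const_poly_def var_poly_def prod_single_1 mult_single w_def)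
  ultimately have "assignment_indicator T \<alpha> * (P01 q k P (shifted_vars q C) - 1)
      = (\<Sum>\<beta>\<in>{..<k} \<rightarrow>\<^sub>E {..<q}. Poly_Mapping.single (wT + w \<beta>) (P \<beta>)) + Poly_Mapping.single wT (- 1)"
    by (simp add: right_diff_distrib sum_distrib_left mult_single single_uminus)
  moreover have "Poly_Mapping.keys wT = (\<lambda>i. (i, \<alpha> i)) ` T"
    unfolding wT_def by (rule keys_sum_single_nat[OF T])
  moreover have "Poly_Mapping.keys (wT + w \<beta>) = s \<beta>" for \<beta>
    unfolding wT_def w_def s_def keys_add_nat
    by (simp only: keys_sum_single_nat[OF T] keys_sum_single_nat[OF finite_lessThan])
  ultimately show ?thesis
    by (simp add: multilinear_form_add multilinear_form_sum multilinear_form_single)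
qed

text \<open>Since \<open>P\<close> is nonnegative, a monomial can cancel only against the one from
  \<open>- 1\<close>. So the reduced polynomial is 0, or some surviving monomial involves every
  index of \<open>T\<close> and of the constraint, and the degree bounds their number. On the
  support of the local distribution exactly one \<beta> is active, it has
  \<open>P \<beta> = 1\<close>, and the two terms cancel pointwise.\<close>

lemma local_expectation_constraint:
  assumes T: "finite T"
    and P: "P \<in> ({..<k} \<rightarrow>\<^sub>E {..<q}) \<rightarrow> {0, 1}" "\<exists>\<beta>\<in>{..<k} \<rightarrow>\<^sub>E {..<q}. P \<beta> = 1"
    and deg: "multilinear_degree (assignment_indicator T \<alpha> * (P01 q k P (shifted_vars q C) - 1)) \<le> r"
    and sat: "\<And>y. card (T \<union> snd C ` {..<k}) \<le> r \<Longrightarrow> y \<in> set_pmf (D (T \<union> snd C ` {..<k})) \<Longrightarrow>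
       \<exists>\<beta>\<in>{..<k} \<rightarrow>\<^sub>E {..<q}. P \<beta> = 1 \<and>
         (\<forall>\<beta>'\<in>{..<k} \<rightarrow>\<^sub>E {..<q}. (\<forall>j<k. y (snd C j) = (\<beta>' j + fst C j) mod q) \<longleftrightarrow> \<beta>' = \<beta>)"
  shows "local_expectation D (assignment_indicator T \<alpha> * (P01 q k P (shifted_vars q C) - 1)) = 0"
proof -
  define sT where "sT = (\<lambda>i. (i, \<alpha> i)) ` T"
  define s where "s \<beta> = sT \<union> (\<lambda>j. (snd C j, (\<beta> j + fst C j) mod q)) ` {..<k}" for \<beta>
  define M where "M = multilinear_form (assignment_indicator T \<alpha> * (P01 q k P (shifted_vars q C) - 1))"
  define V where "V = T \<union> snd C ` {..<k}"
  let ?B = "{..<k} \<rightarrow>\<^sub>E {..<q}"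
  have finB: "finite ?B" by (simp add: finite_PiE)
  have fins: "finite sT" "finite (s \<beta>)" for \<beta> using T by (simp_all add: sT_def s_def)
  have M: "M = (\<Sum>\<beta>\<in>?B. Poly_Mapping.single (sqfree_mon (s \<beta>)) (P \<beta>)) + Poly_Mapping.single (sqfree_mon sT) (- 1)"
    unfolding M_def s_def sT_def by (rule multilinear_form_constraint[OF T])
  have sqfree_mon_eq: "sqfree_mon S = sqfree_mon S' \<longleftrightarrow> S = S'" if "finite S" "finite S'" for S S'
    using that keys_sqfree_mon by metis
  have lookup_M: "Poly_Mapping.lookup M w
      = (\<Sum>\<beta>\<in>?B. if sqfree_mon (s \<beta>) = w then P \<beta> else 0) - (if sqfree_mon sT = w then 1 else 0)" for w
    by (simp add: M lookup_add lookup_sum lookup_single when_def)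
  have idx: "fst ` s \<beta> = V" for \<beta> by (force simp: s_def sT_def V_def)
  have idxT: "fst ` sT = T" by (force simp: sT_def)
  have Pge: "P \<beta> = 0 \<or> P \<beta> = 1" if "\<beta> \<in> ?B" for \<beta> using P(1) that by blast
  show ?thesis
  proof (cases "M = 0")
    case True
    then show ?thesis by (simp add: local_expectation_def M_def[symmetric] eval_poly_def)
  next
    case False
    have keysM: "w = sqfree_mon sT \<or> (\<exists>\<beta>\<in>?B. P \<beta> = 1 \<and> w = sqfree_mon (s \<beta>))" if "w \<in> Poly_Mapping.keys M" for w
    proof (rule ccontr)
      assume no: "\<not> (w = sqfree_mon sT \<or> (\<exists>\<beta>\<in>?B. P \<beta> = 1 \<and> w = sqfree_mon (s \<beta>)))"
      then have "(\<Sum>\<beta>\<in>?B. if sqfree_mon (s \<beta>) = w then P \<beta> else 0) = 0"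
        using Pge by (intro sum.neutral) auto
      then have "Poly_Mapping.lookup M w = 0" using no by (auto simp: lookup_M)
      then show False using that by (simp add: in_keys_iff)
    qed
    \<comment> \<open>If a satisfying \<beta> has \<open>s \<beta> \<noteq> sT\<close>, then the
      term \<open>- 1\<close> does not touch its monomial, whose coefficient is at least 1.\<close>
    have "\<exists>w\<in>Poly_Mapping.keys M. fst ` Poly_Mapping.keys w = V"
    proof (cases "\<exists>\<beta>\<in>?B. P \<beta> = 1 \<and> s \<beta> \<noteq> sT")
      case True
      then obtain \<beta> where \<beta>: "\<beta> \<in> ?B" "P \<beta> = 1" "s \<beta> \<noteq> sT" by blast
      let ?g = "\<lambda>\<beta>'. if sqfree_mon (s \<beta>') = sqfree_mon (s \<beta>) then P \<beta>' else 0"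
      have "?g \<beta> \<le> (\<Sum>\<beta>'\<in>?B. ?g \<beta>')"
      proof (rule member_le_sum[OF \<beta>(1) _ finB])
        show "0 \<le> ?g \<beta>'" if "\<beta>' \<in> ?B - {\<beta>}" for \<beta>'
          using Pge[OF DiffD1[OF that]] by (elim disjE) simp_all
      qed
      moreover have "?g \<beta> = 1" using \<beta>(2) by simp
      moreover have "sqfree_mon sT \<noteq> sqfree_mon (s \<beta>)"
        using sqfree_mon_eq[OF fins] \<beta>(3) by metis
      then have "Poly_Mapping.lookup M (sqfree_mon (s \<beta>)) = (\<Sum>\<beta>'\<in>?B. ?g \<beta>')"
        by (simp only: lookup_M if_False diff_0_right)
      ultimately have "Poly_Mapping.lookup M (sqfree_mon (s \<beta>)) \<noteq> 0" by linarith
      then have "sqfree_mon (s \<beta>) \<in> Poly_Mapping.keys M"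
        by (simp only: in_keys_iff not_False_eq_True)
      then show ?thesis
        using idx[of \<beta>] by (intro bexI[of _ "sqfree_mon (s \<beta>)"]) (simp_all add: keys_sqfree_mon fins)
    next
      case False
      \<comment> \<open>Now every satisfying \<beta> has \<open>s \<beta> = sT\<close>. As one
        exists, the constraint adds no index to \<open>T\<close>, and the only possible monomial
        already involves all of \<open>V\<close>.\<close>
      then have "V = T" using P(2) idx idxT by metis
      have "Poly_Mapping.keys M \<noteq> {}" using \<open>M \<noteq> 0\<close> by simp
      then obtain w where "w \<in> Poly_Mapping.keys M" by blast
      moreover from this have "w = sqfree_mon sT" using keysM False by metis
      ultimately show ?thesis
        using idxT \<open>V = T\<close> by (intro bexI[of _ w]) (simp_all add: keys_sqfree_mon fins)
    qed
    then obtain w where w: "w \<in> Poly_Mapping.keys M" "fst ` Poly_Mapping.keys w = V" by blast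
    have TV: "T \<subseteq> V" by (simp add: V_def)
    have "fst ` Poly_Mapping.keys w' \<subseteq> V" if "w' \<in> Poly_Mapping.keys M" for w'
      using keysM[OF that] TV by (elim disjE bexE) (simp_all add: keys_sqfree_mon fins idx idxT)
    then have inv: "involved_indices M = V"
      using w unfolding involved_indices_def by blast
    have "card V \<le> card (Poly_Mapping.keys w)"
      using w(2) card_image_le[OF finite_keys[of w], of fst] by simp
    also have "\<dots> = (\<Sum>v\<in>Poly_Mapping.keys w. 1)" by simp
    also have "\<dots> \<le> (\<Sum>v\<in>Poly_Mapping.keys w. Poly_Mapping.lookup w v)"
      by (intro sum_mono) (simp add: in_keys_iff Suc_leI)
    also have "\<dots> \<le> total_degree M"
      unfolding total_degree_def using w(1) by (intro Max_ge) auto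
    also have "\<dots> \<le> r" using deg by (simp add: multilinear_degree_def M_def)
    finally have cV: "card V \<le> r" .
    have "eval_poly M (encode y) = 0" if y: "y \<in> set_pmf (D V)" for y
    proof -
      obtain \<beta> where \<beta>: "\<beta> \<in> ?B" "P \<beta> = 1"
        "\<And>\<beta>'. \<beta>' \<in> ?B \<Longrightarrow> (\<forall>j<k. y (snd C j) = (\<beta>' j + fst C j) mod q) \<longleftrightarrow> \<beta>' = \<beta>"
        using sat[of y] cV y unfolding V_def by blast
      have "(\<forall>(i, b)\<in>s \<beta>'. y i = b) \<longleftrightarrow> (\<forall>(i, b)\<in>sT. y i = b) \<and> \<beta>' = \<beta>" if "\<beta>' \<in> ?B" for \<beta>'
        unfolding s_def ball_Un using \<beta>(3)[OF that] by auto
      then have "eval_poly M (encode y) = (\<Sum>\<beta>'\<in>?B. P \<beta>' * of_bool ((\<forall>(i, b)\<in>sT. y i = b) \<and> \<beta>' = \<beta>))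
          - of_bool (\<forall>(i, b)\<in>sT. y i = b)"
        by (simp add: M eval_poly_add eval_poly_sum eval_poly_sqfree_mon fins)
      also have "(\<Sum>\<beta>'\<in>?B. P \<beta>' * of_bool ((\<forall>(i, b)\<in>sT. y i = b) \<and> \<beta>' = \<beta>))
          = (\<Sum>\<beta>'\<in>?B. if \<beta>' = \<beta> then of_bool (\<forall>(i, b)\<in>sT. y i = b) else 0)"
        using \<beta>(2) by (intro sum.cong) auto
      finally show ?thesis using \<beta>(1) finB by simp
    qed
    then have "AE y in measure_pmf (D V). eval_poly M (encode y) = 0"
      by (simp add: AE_measure_pmf_iff)
    then have "measure_pmf.expectation (D V) (\<lambda>y. eval_poly M (encode y)) = 0"
      by (rule integral_eq_zero_AE)
    then show ?thesis by (simp add: local_expectation_def M_def[symmetric] inv)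
  qed
qed

subsection \<open>Expansion of random instances\<close>

lemma pmf_replicate_pmf_of_set:
  assumes A: "finite A" "A \<noteq> {}"
  shows "pmf (replicate_pmf m (pmf_of_set A)) xs
    = of_bool (set xs \<subseteq> A \<and> length xs = m) / real (card A) ^ m"
proof (induction m arbitrary: xs)
  case 0
  then show ?case by (auto simp: indicator_def)
next
  case (Suc m)
  have eq: "replicate_pmf (Suc m) (pmf_of_set A)
      = map_pmf (\<lambda>(x, xs). x # xs) (pair_pmf (pmf_of_set A) (replicate_pmf m (pmf_of_set A)))"
    by (simp add: pair_pmf_def map_bind_pmf)
  show ?case
  proof (cases xs)
    case Nil
    then show ?thesis
      unfolding eq by (subst pmf_map_outside) auto
  next
    case (Cons y ys)
    have "pmf (replicate_pmf (Suc m) (pmf_of_set A)) xs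
        = pmf (pair_pmf (pmf_of_set A) (replicate_pmf m (pmf_of_set A))) (y, ys)"
      unfolding eq Cons
      using pmf_map_inj'[of "\<lambda>(x, xs). x # xs" _ "(y, ys)"] by (auto simp: inj_def)
    then show ?thesis
      using A Suc.IH[of ys] by (simp add: Cons pmf_pair indicator_def)
  qed
qed

lemma prob_replicate_pmf_of_set:
  assumes A: "finite A" "A \<noteq> {}"
  shows "measure_pmf.prob (replicate_pmf m (pmf_of_set A)) {xs. Q xs}
    = card {xs. set xs \<subseteq> A \<and> length xs = m \<and> Q xs} / real (card A) ^ m"
proof -
  let ?S = "{xs. set xs \<subseteq> A \<and> length xs = m \<and> Q xs}"
  have fin: "finite ?S"
    by (rule finite_subset[OF _ finite_lists_length_eq[OF A(1), of m]]) auto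
  have "measure_pmf.prob (replicate_pmf m (pmf_of_set A)) {xs. Q xs}
      = measure_pmf.prob (replicate_pmf m (pmf_of_set A)) ?S"
    using A by (intro measure_pmf.finite_measure_eq_AE)
      (auto simp: AE_measure_pmf_iff set_replicate_pmf in_lists_conv_set)
  also have "\<dots> = (\<Sum>xs\<in>?S. 1 / real (card A) ^ m)"
    unfolding measure_measure_pmf_finite[OF fin]
    by (intro sum.cong) (auto simp: pmf_replicate_pmf_of_set[OF A])
  finally show ?thesis by simp
qed

lemma finite_all_constraints: "finite (all_constraints q k n)"
  by (simp add: all_constraints_def finite_PiE)

lemma card_all_constraints: "card (all_constraints q k n) = q ^ k * n ^ k"
  by (simp add: all_constraints_def card_cartesian_product card_PiE)

lemma all_constraints_nonempty: "0 < q \<Longrightarrow> 0 < n \<Longrightarrow> all_constraints q k n \<noteq> {}"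
  using card_all_constraints[of q k n] by (metis card.empty mult_is_0 power_not_zero neq0_conv)

lemma all_constraints_less:
  assumes "C \<in> all_constraints q k n" "j < k"
  shows "fst C j < q" "snd C j < n"
proof -
  have C: "fst C \<in> {..<k} \<rightarrow>\<^sub>E {..<q}" "snd C \<in> {..<k} \<rightarrow>\<^sub>E {..<n}"
    using assms(1) by (simp_all only: all_constraints_def mem_Times_iff)
  show "fst C j < q" "snd C j < n"
    using PiE_mem[OF C(1)] PiE_mem[OF C(2)] assms(2) by simp_all
qed

section \<open>Coincidences among the variables of slots\<close>

definition slot_var :: "csp_constraint list \<Rightarrow> nat \<times> nat \<Rightarrow> nat" where
  "slot_var xs = (\<lambda>(l, j). snd (xs ! l) j)"

abbreviation random_list :: "nat \<Rightarrow> nat \<Rightarrow> nat \<Rightarrow> nat \<Rightarrow> csp_constraint list pmf" where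
  "random_list q k n m \<equiv> replicate_pmf m (pmf_of_set (all_constraints q k n))"

text \<open>A list with these coincidences is determined by its shifts and by the variables of the
  slots outside \<open>Q\<close>, because \<phi> maps \<open>Q\<close> out of \<open>Q\<close>. This
  loses a factor \<open>n\<close> for each slot of \<open>Q\<close>.\<close>

lemma prob_slots_coincide:
  assumes q: "0 < q" and n: "0 < n" and Q: "Q \<subseteq> {..<m} \<times> {..<k}"
    and \<phi>: "\<phi> ` Q \<subseteq> {..<m} \<times> {..<k} - Q"
  shows "measure_pmf.prob (random_list q k n m) {xs. \<forall>s\<in>Q. slot_var xs s = slot_var xs (\<phi> s)}
           \<le> 1 / real n ^ card Q"
proof -
  define A where "A = {..<m} \<times> {..<k}"
  let ?S = "{xs. set xs \<subseteq> all_constraints q k n \<and> length xs = m \<and> (\<forall>s\<in>Q. slot_var xs s = slot_var xs (\<phi> s))}"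
  define G where "G xs = (restrict (\<lambda>(l, j). fst (xs ! l) j) A, restrict (slot_var xs) (A - Q))"
    for xs :: "csp_constraint list"
  have finA: "finite A" and cardA: "card A = m * k" by (auto simp: A_def card_cartesian_product)
  have finQ: "finite Q" using Q finite_subset by blast
  have mem: "fst (xs ! l) \<in> {..<k} \<rightarrow>\<^sub>E {..<q}" "snd (xs ! l) \<in> {..<k} \<rightarrow>\<^sub>E {..<n}"
    if "xs \<in> ?S" "l < m" for xs l
  proof -
    have "xs ! l \<in> set xs" "set xs \<subseteq> all_constraints q k n" using that by simp_all
    then have "xs ! l \<in> all_constraints q k n" by (rule rev_subsetD)
    then show "fst (xs ! l) \<in> {..<k} \<rightarrow>\<^sub>E {..<q}" "snd (xs ! l) \<in> {..<k} \<rightarrow>\<^sub>E {..<n}"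
      by (simp_all only: all_constraints_def mem_Times_iff)
  qed
  have "inj_on G ?S"
  proof (rule inj_onI)
    fix xs ys assume xs: "xs \<in> ?S" and ys: "ys \<in> ?S" and eq: "G xs = G ys"
    have e1: "fst (xs ! l) j = fst (ys ! l) j" if "l < m" "j < k" for l j
    proof -
      have "restrict (\<lambda>(l, j). fst (xs ! l) j) A (l, j) = restrict (\<lambda>(l, j). fst (ys ! l) j) A (l, j)"
        using eq by (simp add: G_def)
      then show ?thesis using that by (simp add: A_def)
    qed
    have e2: "slot_var xs s = slot_var ys s" if "s \<in> A - Q" for s
    proof -
      have "restrict (slot_var xs) (A - Q) s = restrict (slot_var ys) (A - Q) s"
        using eq by (simp add: G_def)
      then show ?thesis using that by simp
    qed
    have e3: "slot_var xs s = slot_var ys s" if "s \<in> A" for s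
    proof (cases "s \<in> Q")
      case True
      then have "slot_var xs (\<phi> s) = slot_var ys (\<phi> s)"
        using \<phi> by (intro e2) (auto simp: A_def)
      then show ?thesis using True xs ys by simp
    qed (use e2 that in auto)
    have "xs ! l = ys ! l" if l: "l < m" for l
    proof (rule prod_eqI)
      show "fst (xs ! l) = fst (ys ! l)"
        using mem(1)[OF xs l] mem(1)[OF ys l] e1[OF l] by (intro PiE_ext) auto
      have "snd (xs ! l) j = snd (ys ! l) j" if "j < k" for j
        using e3[of "(l, j)"] l that by (simp add: A_def slot_var_def)
      then show "snd (xs ! l) = snd (ys ! l)"
        using mem(2)[OF xs l] mem(2)[OF ys l] by (intro PiE_ext) auto
    qed
    then show "xs = ys" using xs ys by (intro nth_equalityI) auto
  qed
  moreover have "G ` ?S \<subseteq> (A \<rightarrow>\<^sub>E {..<q}) \<times> ((A - Q) \<rightarrow>\<^sub>E {..<n})"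
  proof (rule image_subsetI)
    fix xs assume xs: "xs \<in> ?S"
    have "fst (xs ! l) j \<in> {..<q}" "snd (xs ! l) j \<in> {..<n}" if "l < m" "j < k" for l j
      using PiE_mem[OF mem(1)[OF xs that(1)]] PiE_mem[OF mem(2)[OF xs that(1)]] that(2) by simp_all
    then show "G xs \<in> (A \<rightarrow>\<^sub>E {..<q}) \<times> ((A - Q) \<rightarrow>\<^sub>E {..<n})"
      unfolding G_def mem_Times_iff fst_conv snd_conv restrict_PiE_iff
      by (auto simp: A_def slot_var_def)
  qed
  moreover have "finite ((A \<rightarrow>\<^sub>E {..<q}) \<times> ((A - Q) \<rightarrow>\<^sub>E {..<n}))"
    using finA by (intro finite_cartesian_product finite_PiE) auto
  ultimately have "card ?S \<le> card ((A \<rightarrow>\<^sub>E {..<q}) \<times> ((A - Q) \<rightarrow>\<^sub>E {..<n}))"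
    by (rule card_inj_on_le)
  also have "\<dots> = q ^ (m * k) * n ^ (m * k - card Q)"
    using finA finQ Q by (simp add: card_cartesian_product card_PiE cardA card_Diff_subset A_def)
  finally have "real (card ?S) \<le> real (q ^ (m * k) * n ^ (m * k - card Q))"
    by (rule of_nat_mono)
  moreover have "card Q \<le> m * k" using Q finA cardA card_mono[of A Q] by (simp add: A_def)
  then have "real n ^ (m * k) = real n ^ (m * k - card Q) * real n ^ card Q"
    by (simp add: power_add[symmetric])
  moreover have "real (card (all_constraints q k n)) ^ m = real q ^ (m * k) * real n ^ (m * k)"
    by (simp add: card_all_constraints power_mult_distrib power_mult[symmetric] mult.commute)
  ultimately show ?thesis
    unfolding prob_replicate_pmf_of_set[OF finite_all_constraints all_constraints_nonempty[OF q n]]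
    using q n by (simp add: field_simps)
qed

text \<open>Choose a representative slot for each occurring variable. If at least \<open>e\<close>
  variables are lost, some set \<open>Q\<close> of \<open>e\<close> slots contains no
  representative, and each of its slots repeats the variable of a slot outside \<open>Q\<close>.
  With \<open>N = k * card F\<close> there are at most \<open>2 ^ N * N ^ e\<close> choices of
  \<open>Q\<close> and the map, to which a union bound applies.\<close>

lemma prob_small_image:
  assumes q: "0 < q" and n: "0 < n" and F: "F \<subseteq> {..<m}"
  shows "measure_pmf.prob (random_list q k n m)
           {xs. card (slot_var xs ` (F \<times> {..<k})) + e \<le> k * card F}
         \<le> 2 ^ (k * card F) * (real (k * card F) / real n) ^ e"
proof -
  define A where "A = F \<times> {..<k}"
  define N where "N = k * card F"
  define I where "I = (SIGMA Q:{Q. Q \<subseteq> A \<and> card Q = e}. Q \<rightarrow>\<^sub>E (A - Q))"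
  let ?p = "random_list q k n m"
  let ?Ev = "\<lambda>(Q, \<phi>). {xs. \<forall>s\<in>Q. slot_var xs s = slot_var xs (\<phi> s)}"
  have finF: "finite F" using F finite_subset by blast
  have finA: "finite A" and cardA: "card A = N"
    using finF by (auto simp: A_def N_def card_cartesian_product)
  have finI: "finite I"
    unfolding I_def using finA by (intro finite_SigmaI finite_PiE) (auto intro: finite_subset)
  have cover: "xs \<in> (\<Union>i\<in>I. ?Ev i)" if xs: "card (slot_var xs ` A) + e \<le> N" for xs
  proof -
    define f where "f = slot_var xs"
    define R where "R = inv_into A f ` f ` A"
    have "card R \<le> card (f ` A)" unfolding R_def using finA by (intro card_image_le) auto
    then have cR: "card R + e \<le> card A" using xs cardA by (simp add: f_def)
    have RA: "R \<subseteq> A" unfolding R_def by (rule image_subsetI) (rule inv_into_into)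
    have "e \<le> card (A - R)"
      using cR finA RA finite_subset[OF RA] by (simp add: card_Diff_subset)
    then obtain Q where Q: "Q \<subseteq> A - R" "card Q = e" by (rule obtain_subset_with_card_n)
    define \<phi> where "\<phi> = (\<lambda>s\<in>Q. inv_into A f (f s))"
    have "\<phi> \<in> Q \<rightarrow>\<^sub>E (A - Q)"
    proof -
      have "inv_into A f (f s) \<in> R" if "s \<in> Q" for s
        unfolding R_def using Q that by (intro imageI) auto
      then show ?thesis unfolding \<phi>_def restrict_PiE_iff using RA Q(1) by blast
    qed
    moreover have "f s = f (\<phi> s)" if "s \<in> Q" for s
      using Q that by (auto simp: \<phi>_def f_inv_into_f)
    ultimately show ?thesis
      using Q unfolding I_def f_def by (intro UN_I[of "(Q, \<phi>)"]) auto
  qed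
  have "measure_pmf.prob ?p {xs. card (slot_var xs ` A) + e \<le> N} \<le> measure_pmf.prob ?p (\<Union>i\<in>I. ?Ev i)"
    using cover by (intro measure_pmf.finite_measure_mono) auto
  also have "\<dots> \<le> (\<Sum>i\<in>I. measure_pmf.prob ?p (?Ev i))"
    using finI by (intro measure_pmf.finite_measure_subadditive_finite) auto
  also have "\<dots> \<le> (\<Sum>i\<in>I. 1 / real n ^ e)"
  proof (rule sum_mono)
    fix i assume "i \<in> I"
    then obtain Q \<phi> where i: "i = (Q, \<phi>)" "Q \<subseteq> A" "card Q = e" "\<phi> \<in> Q \<rightarrow>\<^sub>E (A - Q)"
      by (auto simp: I_def)
    have "A \<subseteq> {..<m} \<times> {..<k}" using F by (auto simp: A_def)
    then show "measure_pmf.prob ?p (?Ev i) \<le> 1 / real n ^ e"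
      using prob_slots_coincide[OF q n, of Q m k \<phi>] i by (fastforce simp: PiE_iff)
  qed
  also have "\<dots> = card I / real n ^ e" by simp
  also have "real (card I) \<le> 2 ^ N * real N ^ e"
  proof -
    have "card I = (\<Sum>Q\<in>{Q. Q \<subseteq> A \<and> card Q = e}. card (Q \<rightarrow>\<^sub>E (A - Q)))"
      unfolding I_def using finA by (intro card_SigmaI) (auto intro!: finite_PiE intro: finite_subset)
    also have "\<dots> \<le> (\<Sum>Q\<in>{Q. Q \<subseteq> A \<and> card Q = e}. N ^ e)"
    proof (rule sum_mono)
      fix Q assume Q: "Q \<in> {Q. Q \<subseteq> A \<and> card Q = e}"
      then have "finite Q" using finA finite_subset by auto
      then have "card (Q \<rightarrow>\<^sub>E (A - Q)) = card (A - Q) ^ e" using Q by (simp add: card_PiE)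
      also have "\<dots> \<le> N ^ e"
        using finA cardA card_mono[of A "A - Q"] by (intro power_mono) auto
      finally show "card (Q \<rightarrow>\<^sub>E (A - Q)) \<le> N ^ e" .
    qed
    also have "\<dots> = (N choose e) * N ^ e"
      using n_subsets[OF finA, of e] cardA by simp
    also have "\<dots> \<le> 2 ^ N * N ^ e" by (intro mult_right_mono binomial_le_pow2) auto
    finally have "real (card I) \<le> real (2 ^ N * N ^ e)" by (rule of_nat_mono)
    then show ?thesis by simp
  qed
  finally show ?thesis
    using n by (simp add: A_def N_def power_divide divide_right_mono)
qed

text \<open>\<open>s ^ s / fact s\<close> is a single term of the series for
  \<open>exp s\<close>.\<close>

lemma binomial_le_exp:
  assumes "0 < s"
  shows "real (m choose s) \<le> (exp 1 * real m / real s) ^ s"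
proof -
  have "real s ^ s / fact s \<le> exp (real s)"
  proof -
    have "(\<lambda>i. real s ^ i /\<^sub>R fact i) sums exp (real s)" by (rule exp_converges)
    then have "(\<Sum>i\<in>{s}. real s ^ i /\<^sub>R fact i) \<le> exp (real s)"
      unfolding sums_iff using sum_le_suminf[of "\<lambda>i. real s ^ i /\<^sub>R fact i" "{s}"] by auto
    then show ?thesis by (simp add: divide_inverse mult.commute)
  qed
  then have 1: "real s ^ s \<le> exp 1 ^ s * fact s"
    by (simp add: field_simps exp_of_nat_mult[symmetric])
  have "real (m choose s) * fact s \<le> real m ^ s"
  proof -
    have "(m choose s) * fact s \<le> m ^ s" by (rule binomial_fact_pow)
    then have "real ((m choose s) * fact s) \<le> real (m ^ s)" by (rule of_nat_mono)
    then show ?thesis by simp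
  qed
  then have "(real (m choose s) * fact s) * real s ^ s \<le> real m ^ s * (exp 1 ^ s * fact s)"
    using 1 by (intro mult_mono) auto
  then have "real (m choose s) * real s ^ s \<le> real m ^ s * exp 1 ^ s"
    by (simp add: field_simps)
  then show ?thesis using assms by (simp add: power_divide power_mult_distrib field_simps)
qed

text \<open>For \<open>\<tau> = t / 2 - \<delta>\<close> and \<open>M = 2 * L\<close> the negation
  is the assumption \<open>expansion\<close>.\<close>

definition nonexpanding :: "nat \<Rightarrow> real \<Rightarrow> nat \<Rightarrow> csp_constraint list \<Rightarrow> bool" where
  "nonexpanding k \<tau> M xs \<longleftrightarrow> (\<exists>F \<subseteq> {..<length xs}. F \<noteq> {} \<and> card F \<le> M \<and>
      \<tau> * card F < real k * card F - card (slot_var xs ` (F \<times> {..<k})))"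

text \<open>Union bound over \<open>F\<close>, grouped by size. The hypothesis \<open>small\<close>
  bounds the contribution of the \<open>m choose s\<close> sets of size \<open>s\<close> by
  \<open>\<rho> ^ s\<close>, and for \<open>\<rho> \<le> 1 / 2\<close> the geometric sum is at most
  \<open>2 * \<rho>\<close>.\<close>

lemma prob_nonexpanding:
  assumes q: "0 < q" and n: "0 < n" and k: "0 < k" and \<tau>: "0 \<le> \<tau>" and \<rho>: "\<rho> \<le> 1 / 2"
    and small: "\<And>s. 0 < s \<Longrightarrow> s \<le> M \<Longrightarrow> s \<le> m \<Longrightarrow>
       k * s \<le> n \<and> exp 1 * real m / real s * (2 ^ k * (real (k * s) / real n) powr \<tau>) \<le> \<rho>"
    and \<rho>0: "0 \<le> \<rho>"
  shows "measure_pmf.prob (random_list q k n m) {xs. nonexpanding k \<tau> M xs} \<le> 2 * \<rho>"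
proof -
  let ?p = "random_list q k n m"
  define \<F> where "\<F> = {F. F \<subseteq> {..<m} \<and> F \<noteq> {} \<and> card F \<le> M}"
  \<comment> \<open>The number of lost variables is an integer, so the real bound may be rounded
    up.\<close>
  define e where "e s = nat \<lceil>\<tau> * real s\<rceil>" for s :: nat
  define g where "g s = 2 ^ (k * s) * (real (k * s) / real n) ^ e s" for s
  let ?Ev = "\<lambda>F. {xs. card (slot_var xs ` (F \<times> {..<k})) + e (card F) \<le> k * card F}"
  have fin\<F>: "finite \<F>" unfolding \<F>_def by (rule finite_subset[of _ "Pow {..<m}"]) auto
  have "AE xs in ?p. length xs = m"
    by (auto simp: AE_measure_pmf_iff set_replicate_pmf)
  then have "measure_pmf.prob ?p {xs. nonexpanding k \<tau> M xs} \<le> measure_pmf.prob ?p (\<Union>F\<in>\<F>. ?Ev F)"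
  proof (intro measure_pmf.finite_measure_mono_AE, eventually_elim)
    fix xs :: "csp_constraint list" assume len: "length xs = m"
    show "xs \<in> {xs. nonexpanding k \<tau> M xs} \<longrightarrow> xs \<in> (\<Union>F\<in>\<F>. ?Ev F)"
    proof
      assume "xs \<in> {xs. nonexpanding k \<tau> M xs}"
      then obtain F where F: "F \<in> \<F>"
        "\<tau> * card F < real k * card F - card (slot_var xs ` (F \<times> {..<k}))"
        using len by (auto simp: nonexpanding_def \<F>_def)
      have "\<lceil>\<tau> * card F\<rceil> \<le> int (k * card F) - int (card (slot_var xs ` (F \<times> {..<k})))"
        using F(2) by (intro ceiling_le) simp
      moreover have "0 \<le> \<lceil>\<tau> * card F\<rceil>" using mult_nonneg_nonneg[OF \<tau>, of "real (card F)"] by simp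
      ultimately have "card (slot_var xs ` (F \<times> {..<k})) + nat \<lceil>\<tau> * card F\<rceil> \<le> k * card F"
        by linarith
      then have "xs \<in> ?Ev F" by (simp add: e_def)
      then show "xs \<in> (\<Union>F\<in>\<F>. ?Ev F)" using F(1) by blast
    qed
  qed simp
  also have "\<dots> \<le> (\<Sum>F\<in>\<F>. measure_pmf.prob ?p (?Ev F))"
    using fin\<F> by (intro measure_pmf.finite_measure_subadditive_finite) auto
  also have "\<dots> \<le> (\<Sum>F\<in>\<F>. g (card F))"
  proof (rule sum_mono)
    fix F assume "F \<in> \<F>"
    then have "F \<subseteq> {..<m}" by (simp add: \<F>_def)
    then show "measure_pmf.prob ?p (?Ev F) \<le> g (card F)"
      unfolding g_def by (rule prob_small_image[OF q n])
  qed
  also have "\<dots> = (\<Sum>s\<in>{1..M}. \<Sum>F\<in>{F\<in>\<F>. card F = s}. g (card F))"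
  proof (rule sum.group[symmetric])
    show "card ` \<F> \<subseteq> {1..M}"
      by (auto simp: \<F>_def Suc_le_eq card_gt_0_iff intro: finite_subset[of _ "{..<m}"])
  qed (use fin\<F> in auto)
  also have "\<dots> \<le> (\<Sum>s\<in>{1..M}. \<rho> ^ s)"
  proof (rule sum_mono)
    fix s assume "s \<in> {1..M}"
    then have s: "0 < s" "s \<le> M" by auto
    have "{F \<in> \<F>. card F = s} = {F. F \<subseteq> {..<m} \<and> card F = s}"
      using s by (auto simp: \<F>_def)
    then have "card {F \<in> \<F>. card F = s} = m choose s"
      using n_subsets[of "{..<m}" s] by simp
    then have "(\<Sum>F\<in>{F\<in>\<F>. card F = s}. g (card F)) = real (m choose s) * g s"
      by simp
    also have "\<dots> \<le> \<rho> ^ s"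
    proof (cases "s \<le> m")
      case True
      let ?b = "real (k * s) / real n"
      \<comment> \<open>\<open>k * s \<le> n\<close> makes the base at most 1, so passing to the
        smaller exponent \<open>\<tau> * s\<close> can only increase the power.\<close>
      have "real (k * s) \<le> real n" using small[OF s True] by (simp only: of_nat_le_iff)
      then have b: "0 < ?b" "?b \<le> 1" using k s n by (simp_all del: of_nat_mult)
      have "?b ^ e s = ?b powr real (e s)" using b by (simp add: powr_realpow)
      also have "\<dots> \<le> ?b powr (\<tau> * s)"
      proof (rule powr_mono')
        show "\<tau> * s \<le> real (e s)" unfolding e_def by linarith
      qed (use b in auto)
      also have "\<dots> = (?b powr \<tau>) ^ s"
      proof -
        have "0 < ?b powr \<tau>" using b(1) unfolding powr_gt_zero by linarith
        then show ?thesis by (simp only: powr_powr[symmetric] powr_realpow)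
      qed
      finally have "g s \<le> 2 ^ (k * s) * (?b powr \<tau>) ^ s" by (simp add: g_def)
      also have "\<dots> = (2 ^ k * ?b powr \<tau>) ^ s" by (simp add: power_mult_distrib power_mult)
      finally have "real (m choose s) * g s
          \<le> (exp 1 * real m / real s) ^ s * (2 ^ k * ?b powr \<tau>) ^ s"
        using binomial_le_exp[OF s(1), of m] by (intro mult_mono) (auto simp: g_def)
      also have "\<dots> = (exp 1 * real m / real s * (2 ^ k * ?b powr \<tau>)) ^ s"
        by (simp only: power_mult_distrib)
      also have "\<dots> \<le> \<rho> ^ s"
        using small[OF s True] by (intro power_mono) auto
      finally show ?thesis .
    qed (simp add: \<rho>0 binomial_eq_0)
    finally show "(\<Sum>F\<in>{F\<in>\<F>. card F = s}. g (card F)) \<le> \<rho> ^ s" .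
  qed
  also have "\<dots> \<le> 2 * \<rho>"
  proof -
    have "(1 - \<rho>) * (\<Sum>s\<in>{1..M}. \<rho> ^ s) = \<rho> - \<rho> ^ Suc M"
    proof (induction M)
      case (Suc M)
      have "(1 - \<rho>) * (\<Sum>s\<in>{1..Suc M}. \<rho> ^ s)
          = (1 - \<rho>) * (\<Sum>s\<in>{1..M}. \<rho> ^ s) + (1 - \<rho>) * \<rho> ^ Suc M"
        by (simp add: distrib_left)
      also have "\<dots> = \<rho> - \<rho> ^ Suc (Suc M)"
        unfolding Suc.IH by (simp add: algebra_simps)
      finally show ?case .
    qed simp
    then have "(1 - \<rho>) * (\<Sum>s\<in>{1..M}. \<rho> ^ s) \<le> \<rho>" using \<rho>0 by simp
    moreover have "(1 / 2) * (\<Sum>s\<in>{1..M}. \<rho> ^ s) \<le> (1 - \<rho>) * (\<Sum>s\<in>{1..M}. \<rho> ^ s)"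
      using \<rho> \<rho>0 by (intro mult_right_mono sum_nonneg) auto
    ultimately show ?thesis by simp
  qed
  finally show ?thesis .
qed

subsection \<open>Nonemptiness of the relaxation\<close>

lemma eq_mod_shift_iff:
  fixes a b c q :: nat
  assumes "a < q" "b < q" "c < q"
  shows "a = (b + c) mod q \<longleftrightarrow> b = (a + (q - c)) mod q"
proof
  assume "a = (b + c) mod q"
  then have "(a + (q - c)) mod q = (b + c + (q - c)) mod q" by (simp add: mod_add_left_eq)
  also have "\<dots> = b" using assms by simp
  finally show "b = (a + (q - c)) mod q" by simp
next
  assume "b = (a + (q - c)) mod q"
  then have "(b + c) mod q = (a + (q - c) + c) mod q" by (simp add: mod_add_left_eq)
  also have "\<dots> = a" using assms by simp
  finally show "a = (b + c) mod q" by simp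
qed

text \<open>On the support of a local distribution, \<open>view l y\<close> satisfies
  \<open>P\<close>, and undoing the shift shows that it is the only \<beta> whose monomial is
  nonzero at \<open>y\<close>. This is what \<open>local_expectation_constraint\<close> asks
  for.\<close>

lemma (in relaxed_instance) D_in_SA_plus:
  assumes xs: "length xs = m" "set xs \<subseteq> all_constraints q k n"
    and v: "v = (\<lambda>l. snd (xs ! l))" and c: "c = (\<lambda>l. fst (xs ! l))"
    and P: "P \<in> ({..<k} \<rightarrow>\<^sub>E {..<q}) \<rightarrow> {0, 1}"
    and supp: "set_pmf \<mu> \<subseteq> {z \<in> {..<k} \<rightarrow>\<^sub>E {..<q}. P z = 1}"
  shows "D \<in> SA_plus q n r (R_system q k P (mset xs))"
proof -
  have "local_expectation D (assignment_indicator T \<alpha> * (p - 1)) = 0"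
    if p: "p \<in> R_system q k P (mset xs)" and T: "T \<subseteq> {..<n}"
      and deg: "multilinear_degree (assignment_indicator T \<alpha> * (p - 1)) \<le> r" for p T \<alpha>
  proof -
    from p obtain C where C: "C \<in> set xs" "p = P01 q k P (shifted_vars q C)"
      by (auto simp: R_system_def)
    then obtain l where l: "l < m" "C = xs ! l" using xs(1) by (metis in_set_conv_nth)
    have "C \<in> all_constraints q k n" using C xs by blast
    note fstC = all_constraints_less(1)[OF this] and sndC = all_constraints_less(2)[OF this]
    define V where "V = T \<union> snd C ` {..<k}"
    have Vn: "V \<subseteq> {..<n}" using T sndC by (auto simp: V_def)
    have vl: "v l = snd C" "c l = fst C" using v c l by simp_all
    have nonempty: "\<exists>\<beta>\<in>{..<k} \<rightarrow>\<^sub>E {..<q}. P \<beta> = 1"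
      using supp set_pmf_not_empty[of \<mu>] by blast
    have "\<exists>\<beta>\<in>{..<k} \<rightarrow>\<^sub>E {..<q}. P \<beta> = 1 \<and>
         (\<forall>\<beta>'\<in>{..<k} \<rightarrow>\<^sub>E {..<q}. (\<forall>j<k. y (snd C j) = (\<beta>' j + fst C j) mod q) \<longleftrightarrow> \<beta>' = \<beta>)"
      if V: "card V \<le> r" and y: "y \<in> set_pmf (D V)" for y
    proof -
      have "view l y \<in> set_pmf \<mu>"
        using y l V Vn by (intro D_satisfies[of l V]) (auto simp: vl V_def)
      then have \<beta>: "view l y \<in> {..<k} \<rightarrow>\<^sub>E {..<q}" "P (view l y) = 1" using supp by auto
      have yq: "y (snd C j) < q" if "j < k" for j
        using PiE_mem[of y V "\<lambda>_. {..<q}" "snd C j"] set_D[OF Vn V] y that by (auto simp: V_def)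
      have "(\<forall>j<k. y (snd C j) = (\<beta>' j + fst C j) mod q) \<longleftrightarrow> \<beta>' = view l y"
        if \<beta>': "\<beta>' \<in> {..<k} \<rightarrow>\<^sub>E {..<q}" for \<beta>'
      proof -
        have "(\<forall>j<k. y (snd C j) = (\<beta>' j + fst C j) mod q) \<longleftrightarrow> (\<forall>j<k. \<beta>' j = view l y j)"
        proof (intro all_cong1 imp_cong refl)
          fix j assume j: "j < k"
          have "\<beta>' j < q" using PiE_mem[OF \<beta>', of j] j by simp
          then show "y (snd C j) = (\<beta>' j + fst C j) mod q \<longleftrightarrow> \<beta>' j = view l y j"
            using eq_mod_shift_iff[OF yq[OF j] _ fstC[OF j]] j by (simp add: view_def vl)
        qed
        also have "\<dots> \<longleftrightarrow> \<beta>' = view l y"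
          using PiE_ext[OF \<beta>' \<beta>(1)] by auto
        finally show ?thesis .
      qed
      then show ?thesis using \<beta> by (intro bexI[of _ "view l y"] conjI ballI) auto
    qed
    then show ?thesis
      using deg finite_subset[OF T] unfolding C(2) V_def
      by (intro local_expectation_constraint[OF _ P nonempty]) auto
  qed
  then show ?thesis
    using locally_consistent_D psd_moment_matrix unfolding SA_plus_def SA_def by blast
qed

text \<open>The deterministic half of the argument: randomness enters only through the expansion of
  \<open>xs\<close>.\<close>

lemma SA_plus_nonempty_of_expansion:
  assumes q: "0 < q"
    and P: "P \<in> ({..<k} \<rightarrow>\<^sub>E {..<q}) \<rightarrow> {0, 1}" "uniform_supporting q k (t - 1) P"
    and xs: "set xs \<subseteq> all_constraints q k n"
    and exp: "\<not> nonexpanding k (real t / 2 - \<delta>) (2 * L) xs" and "0 < \<delta>" "0 < L"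
    and "r / \<delta> \<le> L" "k / \<delta> + 1 \<le> r" "2 \<le> r" "(1 / \<delta>) + (k / \<delta> + 2) / \<delta> \<le> L"
  shows "SA_plus q n r (R_system q k P (mset xs)) \<noteq> {}"
proof -
  obtain \<mu> :: "(nat \<Rightarrow> nat) pmf" where
    \<mu>: "set_pmf \<mu> \<subseteq> {z \<in> {..<k} \<rightarrow>\<^sub>E {..<q}. P z = 1} \<and>
        (\<forall>T \<alpha>. T \<subseteq> {..<k} \<and> 1 \<le> card T \<and> card T \<le> t - 1 \<and> \<alpha> \<in> T \<rightarrow>\<^sub>E {..<q} \<longrightarrow>
           measure_pmf.prob \<mu> {z. restrict z T = \<alpha>} = 1 / real q ^ card T)"
    using P(2) unfolding uniform_supporting_def by (rule exE)
  note \<mu>_supp = conjunct1[OF \<mu>] and \<mu>_uniform = conjunct2[OF \<mu>, rule_format]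
  define v where "v = (\<lambda>l. snd (xs ! l))"
  define c where "c = (\<lambda>l. fst (xs ! l))"
  have inst: "csp_instance q k t n (length xs) \<mu> v"
  proof
    show "v l j < n" if "l < length xs" "j < k" for l j
    proof -
      have "xs ! l \<in> set xs" using that by simp
      then have "xs ! l \<in> all_constraints q k n" using xs by blast
      then show ?thesis using that(2) unfolding v_def by (rule all_constraints_less(2))
    qed
    show "measure_pmf.prob \<mu> {z. restrict z T = \<alpha>} = 1 / real q ^ card T"
      if T: "T \<subseteq> {..<k}" "card T < t" "\<alpha> \<in> T \<rightarrow>\<^sub>E {..<q}" for T \<alpha>
    \<comment> \<open>\<open>uniform_supporting\<close> says nothing about the empty set, where both
      sides are 1.\<close>
    proof (cases "T = {}")
      case True
      then have "{z. restrict z T = \<alpha>} = UNIV" using T by (auto simp: fun_eq_iff)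
      then show ?thesis using True by simp
    next
      case False
      moreover have "finite T" using T finite_subset by blast
      ultimately have "1 \<le> card T" by (simp add: Suc_leI card_gt_0_iff)
      then show ?thesis using T by (intro \<mu>_uniform) simp
    qed
  qed (use q \<mu>_supp in auto)
  then interpret csp_instance q k t n "length xs" \<mu> v c .
  have nbr: "nbr F = slot_var xs ` (F \<times> {..<k})" for F
    unfolding nbr_def slot_var_def by (force simp: v_def)
  interpret relaxed_instance q k t n "length xs" \<mu> v c L \<delta> r
  proof
    show "real k * card F - card (nbr F) \<le> (real t / 2 - \<delta>) * card F"
      if "F \<subseteq> {..<length xs}" "F \<noteq> {}" "card F \<le> 2 * L" for F
      using exp that unfolding nonexpanding_def nbr by (meson not_le)
  qed (use assms in auto)
  have "D \<in> SA_plus q n r (R_system q k P (mset xs))"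
    using xs P(1) \<mu>_supp by (intro D_in_SA_plus) (auto simp: v_def c_def)
  then show ?thesis by blast
qed

section \<open>Choice of parameters and passage to the limit\<close>

theorem theorem1p3:
  fixes q k t :: nat and \<epsilon> :: real and P :: "(nat \<Rightarrow> nat) \<Rightarrow> real"
  assumes "q \<ge> 2" and "k \<ge> 1" and "t \<ge> 3" and "\<epsilon> > 0"
    and "P \<in> ({..<k} \<rightarrow>\<^sub>E {..<q}) \<rightarrow> {0, 1}"
    and "uniform_supporting q k (t - 1) P"
  shows "\<exists>r :: nat \<Rightarrow> nat.
           (\<lambda>n. real (r n)) \<in> \<Omega>(\<lambda>n. real n powr (\<epsilon> / (real t - 2))) \<and>
           (\<forall>m :: nat \<Rightarrow> nat.
              (\<forall>\<^sub>F n in sequentially. real (m n) \<le> real n powr (real t / 2 - \<epsilon>)) \<longrightarrow>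
              (\<lambda>n. measure_pmf.prob (random_instance q k n (m n))
                     {I. SA_plus q n (r n) (R_system q k P I) \<noteq> {}}) \<longlonglongrightarrow> 1)"
proof -
  define a where "a = \<epsilon> / (real t - 2)"
  \<comment> \<open>\<open>\<delta> \<le> \<epsilon> / 4\<close> leaves the exponent
    \<open>- \<epsilon> / 4\<close> in \<open>\<rho>\<close>, and
    \<open>\<delta> \<le> 1 / 4\<close> ensures \<open>\<tau> \<ge> 1\<close> for
    \<open>t \<ge> 3\<close>.\<close>
  define \<delta> where "\<delta> = min \<epsilon> 1 / 4"
  define \<tau> where "\<tau> = real t / 2 - \<delta>"
  define r where "r n = nat \<lceil>real n powr a\<rceil>" for n
  \<comment> \<open>For large \<open>n\<close>, \<open>r n\<close> is at most
    \<open>2 * real n powr a\<close>, so the factor \<open>2 / \<delta>\<close> yields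
    \<open>r n / \<delta> \<le> L n\<close>. The constant \<open>A\<close> is such that then
    \<open>2 * L n \<le> A * real n powr a\<close>.\<close>
  define L where "L n = nat \<lceil>(2 / \<delta>) * real n powr a\<rceil>" for n
  define A where "A = 4 / \<delta> + 2"
  \<comment> \<open>\<open>B\<close> collects the constants of the union bound once \<open>s\<close>
    is replaced by \<open>A * real n powr a\<close>.\<close>
  define B where "B = exp 1 * 2 ^ k * real k powr \<tau> * A powr (\<tau> - 1)"
  define \<rho> where "\<rho> n = B * real n powr (- \<epsilon> / 4)" for n
  have a: "0 < a" using assms by (simp add: a_def)
  have \<delta>: "0 < \<delta>" "\<delta> \<le> \<epsilon> / 4" "\<delta> \<le> 1 / 4" using assms by (auto simp: \<delta>_def)
  have \<tau>: "1 \<le> \<tau>" using assms \<delta> by (simp add: \<tau>_def)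
  have A: "0 < A" using \<delta> by (simp add: A_def add_pos_pos)
  have B: "0 \<le> B" by (simp add: B_def)
  have at_top: "filterlim (\<lambda>n. real n powr a) at_top sequentially"
    using a by real_asymp
  have \<rho>_lim: "\<rho> \<longlonglongrightarrow> 0"
    unfolding \<rho>_def using assms by real_asymp
  have "(\<lambda>n. real (r n)) \<in> \<Omega>(\<lambda>n. real n powr a)"
  proof (rule landau_omega.bigI[of 1])
    have "real n powr a \<le> real (r n)" for n
      unfolding r_def by (rule real_nat_ceiling_ge)
    then show "\<forall>\<^sub>F n in sequentially. 1 * norm (real n powr a) \<le> norm (real (r n))"
      by (intro always_eventually allI) simp
  qed simp
  moreover have "(\<lambda>n. measure_pmf.prob (random_instance q k n (m n))
                     {I. SA_plus q n (r n) (R_system q k P I) \<noteq> {}}) \<longlonglongrightarrow> 1"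
    if m: "\<forall>\<^sub>F n in sequentially. real (m n) \<le> real n powr (real t / 2 - \<epsilon>)" for m
  proof -
    have large: "\<forall>\<^sub>F n in sequentially. b \<le> real n powr a" for b
      using at_top unfolding filterlim_at_top by blast
    \<comment> \<open>If \<open>a \<ge> 1\<close> then the bound \<open>2 * L n\<close> on the size of constraint sets may exceed \<open>n\<close>, but then
      there are few constraints altogether.\<close>
    have few_slots: "\<forall>\<^sub>F n in sequentially. k * A * real n powr a \<le> n \<or>
        k * real n powr (real t / 2 - \<epsilon>) \<le> n"
    proof (cases "a < 1")
      case True
      then have "\<forall>\<^sub>F n in sequentially. k * A * real n powr a \<le> n"
        by real_asymp
      then show ?thesis by eventually_elim simp
    next
      case False
      then have "real t - 2 \<le> \<epsilon>" using assms by (simp add: a_def field_simps)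
      then have "real t / 2 - \<epsilon> < 1" using assms by simp
      then have "\<forall>\<^sub>F n in sequentially. k * real n powr (real t / 2 - \<epsilon>) \<le> n"
        by real_asymp
      then show ?thesis by eventually_elim simp
    qed
    have "\<forall>\<^sub>F n in sequentially. \<rho> n \<le> 1 / 2"
      using order_tendstoD(2)[OF \<rho>_lim, of "1 / 2"] by (auto elim: eventually_mono)
    with m few_slots large[of 2] large[of "k / \<delta> + 1"] large[of "((1 / \<delta>) + (k / \<delta> + 2) / \<delta>) * \<delta> / 2"]
      eventually_gt_at_top[of 0]
    have lower: "\<forall>\<^sub>F n in sequentially. 1 - 2 * \<rho> n \<le> measure_pmf.prob (random_instance q k n (m n))
                     {I. SA_plus q n (r n) (R_system q k P I) \<noteq> {}}"
    proof eventually_elim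
      case (elim n)
      define x where "x = real n powr a"
      have n: "1 \<le> real n" using elim by simp
      have x: "2 \<le> x" "k / \<delta> + 1 \<le> x" "((1 / \<delta>) + (k / \<delta> + 2) / \<delta>) * \<delta> / 2 \<le> x"
        using elim by (simp_all add: x_def)
      have rx: "x \<le> r n" "r n \<le> 2 * x"
        using x(1) unfolding r_def x_def by linarith+
      have "0 \<le> (2 / \<delta>) * x" using x \<delta> by simp
      then have Lx: "(2 / \<delta>) * x \<le> L n" "L n \<le> (2 / \<delta>) * x + 1"
        unfolding L_def x_def by linarith+
      have "2 * real (L n) \<le> A * x"
      proof -
        have "A * x = 2 * ((2 / \<delta>) * x) + 2 * x" by (simp add: A_def algebra_simps)
        then show ?thesis using Lx(2) x(1) by linarith
      qed
      then have LA: "real (2 * L n) \<le> A * x" by simp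
      have cond: "k * s \<le> n \<and> exp 1 * real (m n) / real s * (2 ^ k * (real (k * s) / real n) powr \<tau>) \<le> \<rho> n"
        if s: "0 < s" "s \<le> 2 * L n" "s \<le> m n" for s
      proof
        have sA: "real s \<le> A * x" using s(2) LA by (meson of_nat_mono order_trans)
        have sm: "real s \<le> real n powr (real t / 2 - \<epsilon>)"
          using s(3) elim(1) by (meson of_nat_mono order_trans)
        from elim(2) have "real k * real s \<le> n"
        proof
          assume "k * A * real n powr a \<le> n"
          moreover have "real k * real s \<le> real k * (A * x)" using sA by (rule mult_left_mono) simp
          ultimately show ?thesis by (simp add: x_def mult.assoc)
        next
          assume "k * real n powr (real t / 2 - \<epsilon>) \<le> n"
          moreover have "real k * real s \<le> k * real n powr (real t / 2 - \<epsilon>)"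
            using sm by (rule mult_left_mono) simp
          ultimately show ?thesis by simp
        qed
        then show "k * s \<le> n" by (metis of_nat_le_iff of_nat_mult)
        \<comment> \<open>The factor \<open>1 / s\<close> is absorbed into
          \<open>s powr (\<tau> - 1)\<close>, which is nondecreasing in \<open>s\<close> because
          \<open>\<tau> \<ge> 1\<close>; so the upper bound for \<open>s\<close> may be
          inserted.\<close>
        have "exp 1 * real (m n) / real s * (2 ^ k * (real (k * s) / real n) powr \<tau>)
            = exp 1 * 2 ^ k * real k powr \<tau> * (real (m n) * real s powr (\<tau> - 1) * real n powr (- \<tau>))"
          using s n by (simp add: powr_divide powr_mult powr_diff powr_minus field_simps)
        also have "\<dots> \<le> exp 1 * 2 ^ k * real k powr \<tau> *
            (real n powr (real t / 2 - \<epsilon>) * (A * x) powr (\<tau> - 1) * real n powr (- \<tau>))"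
          using elim(1) sA \<tau> by (intro mult_left_mono mult_right_mono mult_mono powr_mono2) auto
        also have "\<dots> = B * real n powr ((real t / 2 - \<epsilon>) + a * (\<tau> - 1) - \<tau>)"
        proof -
          have "(A * x) powr (\<tau> - 1) = A powr (\<tau> - 1) * real n powr (a * (\<tau> - 1))"
            using A by (simp add: x_def powr_mult powr_powr)
          moreover have "real n powr ((real t / 2 - \<epsilon>) + a * (\<tau> - 1) - \<tau>)
              = real n powr (real t / 2 - \<epsilon>) * real n powr (a * (\<tau> - 1)) * real n powr (- \<tau>)"
            using powr_add[of "real n" "(real t / 2 - \<epsilon>) + a * (\<tau> - 1)" "- \<tau>"]
              powr_add[of "real n" "real t / 2 - \<epsilon>" "a * (\<tau> - 1)"] by simp
          ultimately show ?thesis by (simp add: B_def)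
        qed
        also have "\<dots> \<le> \<rho> n"
        proof -
          have at2: "a * (real t - 2) = \<epsilon>" using assms by (simp add: a_def)
          \<comment> \<open>By the choice of \<open>a\<close>, the growth of the set sizes costs at
            most \<open>\<epsilon> / 2\<close> of the \<open>\<epsilon>\<close> saved in the number
            of constraints.\<close>
          have "a * (\<tau> - 1) = \<epsilon> / 2 - a * \<delta>"
            unfolding \<tau>_def at2[symmetric] by (simp add: algebra_simps)
          then have "(real t / 2 - \<epsilon>) + a * (\<tau> - 1) - \<tau> = - \<epsilon> / 2 - a * \<delta> + \<delta>"
            by (simp add: \<tau>_def)
          also have "\<dots> \<le> - \<epsilon> / 4" using \<delta> mult_pos_pos[OF a \<delta>(1)] by linarith
          finally show ?thesis
            unfolding \<rho>_def using B n by (intro mult_left_mono powr_mono) auto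
        qed
        finally show "exp 1 * real (m n) / real s * (2 ^ k * (real (k * s) / real n) powr \<tau>) \<le> \<rho> n" .
      qed
      let ?p = "random_list q k n (m n)"
      have "measure_pmf.prob ?p {xs. nonexpanding k \<tau> (2 * L n) xs} \<le> 2 * \<rho> n"
        using assms elim \<tau> cond B by (intro prob_nonexpanding) (auto simp: \<rho>_def)
      then have "1 - 2 * \<rho> n \<le> measure_pmf.prob ?p (- {xs. nonexpanding k \<tau> (2 * L n) xs})"
        using measure_pmf.prob_compl[of "{xs. nonexpanding k \<tau> (2 * L n) xs}" ?p]
        by (simp add: Compl_eq_Diff_UNIV)
      also have "\<dots> \<le> measure_pmf.prob ?p {xs. SA_plus q n (r n) (R_system q k P (mset xs)) \<noteq> {}}"
      proof (rule measure_pmf.finite_measure_mono_AE)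
        have "SA_plus q n (r n) (R_system q k P (mset xs)) \<noteq> {}"
          if xs: "xs \<in> set_pmf ?p" and exp: "\<not> nonexpanding k \<tau> (2 * L n) xs" for xs
        proof (rule SA_plus_nonempty_of_expansion[OF _ assms(5,6)])
          show "set xs \<subseteq> all_constraints q k n"
            using xs assms elim all_constraints_nonempty[of q n k]
            by (auto simp: set_replicate_pmf finite_all_constraints in_lists_conv_set)
          show "\<not> nonexpanding k (real t / 2 - \<delta>) (2 * L n) xs" using exp by (simp add: \<tau>_def)
          have "2 / \<delta> * 2 \<le> 2 / \<delta> * x" using x(1) \<delta> by (intro mult_left_mono) auto
          then have "0 < real (L n)" using Lx(1) \<delta> by (smt (verit) divide_pos_pos mult_pos_pos)
          then show "0 < L n" by simp
          have "r n / \<delta> \<le> 2 * x / \<delta>" using rx(2) \<delta> by (intro divide_right_mono) auto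
          then show "r n / \<delta> \<le> L n" using Lx(1) by simp
          show "k / \<delta> + 1 \<le> r n" using rx(1) x(2) by linarith
          show "2 \<le> r n" using rx(1) x(1) by linarith
          have "(1 / \<delta>) + (k / \<delta> + 2) / \<delta> \<le> (2 / \<delta>) * x"
            using x(3) \<delta>(1) by (simp add: field_simps)
          then show "(1 / \<delta>) + (k / \<delta> + 2) / \<delta> \<le> L n" using Lx(1) by linarith
        qed (use assms \<delta> in auto)
        then show "AE xs in ?p. xs \<in> - {xs. nonexpanding k \<tau> (2 * L n) xs} \<longrightarrow>
            xs \<in> {xs. SA_plus q n (r n) (R_system q k P (mset xs)) \<noteq> {}}"
          by (simp add: AE_measure_pmf_iff)
      qed simp
      finally show ?case
        by (simp add: random_instance_def vimage_def)
    qed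
    have "(\<lambda>n. 1 - 2 * \<rho> n) \<longlonglongrightarrow> 1 - 2 * 0"
      by (intro tendsto_intros \<rho>_lim)
    then show ?thesis
      using lower by (intro tendsto_sandwich[OF lower _ _ tendsto_const]) auto
  qed
  ultimately show ?thesis unfolding a_def by blast
qed

end
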